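(* Let $R$ be a commutative ring, $\mathcal A$ an associative $R$-algebra with center $Z(\mathcal A)$, and $(\mathcal A[[\nu]],\star)$ a formal deformation of $\mathcal A$. Consider the Poisson algebra $(Z(\mathcal A)\times\mathcal A,\cdot,\{\cdot,\cdot\})$ and the commutative Poisson algebra $(\Pi(\mathcal A),\cdot,\{\cdot,\cdot\})$, $\Pi(\mathcal A)=Z(\mathcal A)\times(\mathcal A/Z(\mathcal A))$, associated to the deformation. Then: (1) $\mathcal A$ is a Poisson module over $(Z(\mathcal A)\times\mathcal A,\cdot,\{\cdot,\cdot\})$, with left action, right action and Lie action obtained by identifying $\mathcal A$ with $\{0\}\times\mathcal A\subset Z(\mathcal A)\times\mathcal A$ and restricting left multiplication, right multiplication and the Poisson bracket of $Z(\mathcal A)\times\mathcal A$. (2) $\mathcal A$ is a Poisson module over $(\Pi(\mathcal A),\cdot,\{\cdot,\cdot\})$, with actions given for $a\in Z(\mathcal A)$ and $a_1,b\in\mathcal A$ by $$(a,\overline{a_1})\cdot b=ab,\qquad b\cdot(a,\overline{a_1})=ba=ab,\qquad \{(a,\overline{a_1});b\}=\{a,b\}_1+[a_1,b].$$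
   Context: Associative algebras are unital, not necessarily commutative; $[a,b]=ab-ba$ in $\mathcal A$. A (not necessarily commutative) Poisson algebra is an associative algebra with a Lie bracket $\{\cdot,\cdot\}$ satisfying $\{a,bc\}=\{a,b\}c+b\{a,c\}$. Poisson module: for a Poisson algebra $(\mathcal P,\cdot,\{\cdot,\cdot\})$ over $R$, an $R$-module $M$ is a $\mathcal P$-Poisson module if it is a $(\mathcal P,\cdot)$-bimodule (actions $a\cdot m$, $m\cdot a$) and a Lie module over $(\mathcal P,\{\cdot,\cdot\})$ (action $\{a;m\}$, with $\{\{a,b\};m\}=\{a;\{b;m\}\}-\{b;\{a;m\}\}$) such that for all $a,b\in\mathcal P$, $m\in M$: $\{a;b\cdot m\}=\{a,b\}\cdot m+b\cdot\{a;m\}$, $\{a;m\cdot b\}=m\cdot\{a,b\}+\{a;m\}\cdot b$, and $\{a\cdot b;m\}=a\cdot\{b;m\}+\{a;m\}\cdot b$. Formal deformation: an associative $R[[\nu]]$-algebra structure $\star$ on $\mathcal A[[\nu]]$ with $a\star b-ab\in\nu\mathcal A[[\nu]]$ for $a,b\in\mathcal A$. For $a,b\in\mathcal A$ write $a\star b=ab+\nu(a,b)_1+\nu^2(a,b)_2+\cdots$ and $a\star b-b\star a=[a,b]+\nu\{a,b\}_1+\nu^2\{a,b\}_2+\cdots$, so $\{a,b\}_i=(a,b)_i-(b,a)_i$. Let $\mathcal H_\nu:=Z(\mathcal A)+\nu\mathcal A[[\nu]]$ with product $\star$ and bracket $[A,B]_\nu:=\frac1\nu(A\star B-B\star A)$;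 it is a Poisson algebra. The submodule $\nu^2\mathcal A[[\nu]]$ is a Poisson ideal of it, and the quotient is identified with $Z(\mathcal A)\times\mathcal A$ via $a_0+\nu a_1+\cdots\mapsto(a_0,a_1)$; explicitly its product and bracket are $(a,a_1)\cdot(b,b_1)=(ab,\,ab_1+a_1b+(a,b)_1)$ and $\{(a,a_1),(b,b_1)\}=(\{a,b\}_1,\,\{a,b\}_2+\{a_1,b\}_1+\{a,b_1\}_1+[a_1,b_1])$. Similarly $\nu\mathcal H_\nu$ is a Poisson ideal and $\mathcal H_\nu/\nu\mathcal H_\nu$ is identified with $\Pi(\mathcal A)=Z(\mathcal A)\times(\mathcal A/Z(\mathcal A))$ (quotient of $R$-modules) via $a_0+\nu a_1+\cdots\mapsto(a_0,\overline{a_1})$, $\overline{b}=b+Z(\mathcal A)$; the product and bracket on $\Pi(\mathcal A)$ are given by the same formulas with second components taken modulo $Z(\mathcal A)$. *)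

theory Defs
  imports "HOL-Algebra.Module" "HOL-Algebra.AbelCoset"
begin

section \<open>Associative algebras, Poisson algebras and Poisson modules\<close>

text \<open>The library locale \<open>algebra\<close> requires a commutative multiplication, so unital,
  not necessarily commutative, associative algebras are introduced here.\<close>

locale assoc_algebra = A?: ring A + module R A
  for R (structure) and A (structure) +
  assumes smult_mult_left:
      "\<lbrakk>r \<in> carrier R; x \<in> carrier A; y \<in> carrier A\<rbrakk> \<Longrightarrow>
        (r \<odot>\<^bsub>A\<^esub> x) \<otimes>\<^bsub>A\<^esub> y = r \<odot>\<^bsub>A\<^esub> (x \<otimes>\<^bsub>A\<^esub> y)"
    and smult_mult_right:
      "\<lbrakk>r \<in> carrier R; x \<in> carrier A; y \<in> carrier A\<rbrakk> \<Longrightarrow>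
        x \<otimes>\<^bsub>A\<^esub> (r \<odot>\<^bsub>A\<^esub> y) = r \<odot>\<^bsub>A\<^esub> (x \<otimes>\<^bsub>A\<^esub> y)"

record ('r, 'p) poisson = "('r, 'p) module" +
  bracket :: "['p, 'p] \<Rightarrow> 'p"

locale poisson_algebra = assoc_algebra R P
  for R (structure) and P :: "('r, 'p, 'm) poisson_scheme" (structure) +
  assumes bracket_closed:
      "\<lbrakk>a \<in> carrier P; b \<in> carrier P\<rbrakk> \<Longrightarrow> bracket P a b \<in> carrier P"
    and bracket_add_left:
      "\<lbrakk>a \<in> carrier P; b \<in> carrier P; c \<in> carrier P\<rbrakk> \<Longrightarrow>
        bracket P (a \<oplus>\<^bsub>P\<^esub> b) c = bracket P a c \<oplus>\<^bsub>P\<^esub> bracket P b c"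
    and bracket_add_right:
      "\<lbrakk>a \<in> carrier P; b \<in> carrier P; c \<in> carrier P\<rbrakk> \<Longrightarrow>
        bracket P a (b \<oplus>\<^bsub>P\<^esub> c) = bracket P a b \<oplus>\<^bsub>P\<^esub> bracket P a c"
    and bracket_smult_left:
      "\<lbrakk>r \<in> carrier R; a \<in> carrier P; b \<in> carrier P\<rbrakk> \<Longrightarrow>
        bracket P (r \<odot>\<^bsub>P\<^esub> a) b = r \<odot>\<^bsub>P\<^esub> bracket P a b"
    and bracket_smult_right:
      "\<lbrakk>r \<in> carrier R; a \<in> carrier P; b \<in> carrier P\<rbrakk> \<Longrightarrow>
        bracket P a (r \<odot>\<^bsub>P\<^esub> b) = r \<odot>\<^bsub>P\<^esub> bracket P a b"
    and bracket_alternating: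
      "a \<in> carrier P \<Longrightarrow> bracket P a a = \<zero>\<^bsub>P\<^esub>"
    and bracket_jacobi:
      "\<lbrakk>a \<in> carrier P; b \<in> carrier P; c \<in> carrier P\<rbrakk> \<Longrightarrow>
        bracket P a (bracket P b c) \<oplus>\<^bsub>P\<^esub> bracket P b (bracket P c a)
          \<oplus>\<^bsub>P\<^esub> bracket P c (bracket P a b) = \<zero>\<^bsub>P\<^esub>"
    and bracket_leibniz:
      "\<lbrakk>a \<in> carrier P; b \<in> carrier P; c \<in> carrier P\<rbrakk> \<Longrightarrow>
        bracket P a (b \<otimes>\<^bsub>P\<^esub> c) = bracket P a b \<otimes>\<^bsub>P\<^esub> c \<oplus>\<^bsub>P\<^esub> b \<otimes>\<^bsub>P\<^esub> bracket P a c"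

locale commutative_poisson_algebra = poisson_algebra R P + comm_monoid P
  for R (structure) and P :: "('r, 'p, 'm) poisson_scheme" (structure)

text \<open>Only the module part of the record \<open>M\<close> is used. The arguments \<open>lact p m\<close>, \<open>ract m p\<close>
  and \<open>lie p m\<close> are the left action \<open>p \<cdot> m\<close>, the right action \<open>m \<cdot> p\<close> and the
  Lie action \<open>{p; m}\<close>.\<close>

locale poisson_module = poisson_algebra R P + M?: module R M
  for R (structure) and P :: "('r, 'p, 'k) poisson_scheme" (structure)
    and M :: "('r, 'm, 'l) module_scheme" (structure) +
  fixes lact :: "'p \<Rightarrow> 'm \<Rightarrow> 'm" and ract :: "'m \<Rightarrow> 'p \<Rightarrow> 'm" and lie :: "'p \<Rightarrow> 'm \<Rightarrow> 'm"
  assumes lact_closed: "\<lbrakk>p \<in> carrier P; m \<in> carrier M\<rbrakk> \<Longrightarrow> lact p m \<in> carrier M"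
    and lact_add_left: "\<lbrakk>p \<in> carrier P; q \<in> carrier P; m \<in> carrier M\<rbrakk> \<Longrightarrow>
      lact (p \<oplus>\<^bsub>P\<^esub> q) m = lact p m \<oplus>\<^bsub>M\<^esub> lact q m"
    and lact_add_right: "\<lbrakk>p \<in> carrier P; m \<in> carrier M; n \<in> carrier M\<rbrakk> \<Longrightarrow>
      lact p (m \<oplus>\<^bsub>M\<^esub> n) = lact p m \<oplus>\<^bsub>M\<^esub> lact p n"
    and lact_smult_left: "\<lbrakk>r \<in> carrier R; p \<in> carrier P; m \<in> carrier M\<rbrakk> \<Longrightarrow>
      lact (r \<odot>\<^bsub>P\<^esub> p) m = r \<odot>\<^bsub>M\<^esub> lact p m"
    and lact_smult_right: "\<lbrakk>r \<in> carrier R; p \<in> carrier P; m \<in> carrier M\<rbrakk> \<Longrightarrow>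
      lact p (r \<odot>\<^bsub>M\<^esub> m) = r \<odot>\<^bsub>M\<^esub> lact p m"
    and lact_one: "m \<in> carrier M \<Longrightarrow> lact \<one>\<^bsub>P\<^esub> m = m"
    and lact_mult: "\<lbrakk>p \<in> carrier P; q \<in> carrier P; m \<in> carrier M\<rbrakk> \<Longrightarrow>
      lact (p \<otimes>\<^bsub>P\<^esub> q) m = lact p (lact q m)"
    and ract_closed: "\<lbrakk>m \<in> carrier M; p \<in> carrier P\<rbrakk> \<Longrightarrow> ract m p \<in> carrier M"
    and ract_add_left: "\<lbrakk>m \<in> carrier M; n \<in> carrier M; p \<in> carrier P\<rbrakk> \<Longrightarrow>
      ract (m \<oplus>\<^bsub>M\<^esub> n) p = ract m p \<oplus>\<^bsub>M\<^esub> ract n p"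
    and ract_add_right: "\<lbrakk>m \<in> carrier M; p \<in> carrier P; q \<in> carrier P\<rbrakk> \<Longrightarrow>
      ract m (p \<oplus>\<^bsub>P\<^esub> q) = ract m p \<oplus>\<^bsub>M\<^esub> ract m q"
    and ract_smult_left: "\<lbrakk>r \<in> carrier R; m \<in> carrier M; p \<in> carrier P\<rbrakk> \<Longrightarrow>
      ract (r \<odot>\<^bsub>M\<^esub> m) p = r \<odot>\<^bsub>M\<^esub> ract m p"
    and ract_smult_right: "\<lbrakk>r \<in> carrier R; m \<in> carrier M; p \<in> carrier P\<rbrakk> \<Longrightarrow>
      ract m (r \<odot>\<^bsub>P\<^esub> p) = r \<odot>\<^bsub>M\<^esub> ract m p"
    and ract_one: "m \<in> carrier M \<Longrightarrow> ract m \<one>\<^bsub>P\<^esub> = m"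
    and ract_mult: "\<lbrakk>m \<in> carrier M; p \<in> carrier P; q \<in> carrier P\<rbrakk> \<Longrightarrow>
      ract m (p \<otimes>\<^bsub>P\<^esub> q) = ract (ract m p) q"
    and lact_ract: "\<lbrakk>p \<in> carrier P; m \<in> carrier M; q \<in> carrier P\<rbrakk> \<Longrightarrow>
      ract (lact p m) q = lact p (ract m q)"
    and lie_closed: "\<lbrakk>p \<in> carrier P; m \<in> carrier M\<rbrakk> \<Longrightarrow> lie p m \<in> carrier M"
    and lie_add_left: "\<lbrakk>p \<in> carrier P; q \<in> carrier P; m \<in> carrier M\<rbrakk> \<Longrightarrow>
      lie (p \<oplus>\<^bsub>P\<^esub> q) m = lie p m \<oplus>\<^bsub>M\<^esub> lie q m"
    and lie_add_right: "\<lbrakk>p \<in> carrier P; m \<in> carrier M; n \<in> carrier M\<rbrakk> \<Longrightarrow>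
      lie p (m \<oplus>\<^bsub>M\<^esub> n) = lie p m \<oplus>\<^bsub>M\<^esub> lie p n"
    and lie_smult_left: "\<lbrakk>r \<in> carrier R; p \<in> carrier P; m \<in> carrier M\<rbrakk> \<Longrightarrow>
      lie (r \<odot>\<^bsub>P\<^esub> p) m = r \<odot>\<^bsub>M\<^esub> lie p m"
    and lie_smult_right: "\<lbrakk>r \<in> carrier R; p \<in> carrier P; m \<in> carrier M\<rbrakk> \<Longrightarrow>
      lie p (r \<odot>\<^bsub>M\<^esub> m) = r \<odot>\<^bsub>M\<^esub> lie p m"
    and lie_bracket: "\<lbrakk>p \<in> carrier P; q \<in> carrier P; m \<in> carrier M\<rbrakk> \<Longrightarrow>
      lie (bracket P p q) m = lie p (lie q m) \<ominus>\<^bsub>M\<^esub> lie q (lie p m)"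
    and lie_lact: "\<lbrakk>p \<in> carrier P; q \<in> carrier P; m \<in> carrier M\<rbrakk> \<Longrightarrow>
      lie p (lact q m) = lact (bracket P p q) m \<oplus>\<^bsub>M\<^esub> lact q (lie p m)"
    and lie_ract: "\<lbrakk>p \<in> carrier P; q \<in> carrier P; m \<in> carrier M\<rbrakk> \<Longrightarrow>
      lie p (ract m q) = ract m (bracket P p q) \<oplus>\<^bsub>M\<^esub> ract (lie p m) q"
    and lie_mult: "\<lbrakk>p \<in> carrier P; q \<in> carrier P; m \<in> carrier M\<rbrakk> \<Longrightarrow>
      lie (p \<otimes>\<^bsub>P\<^esub> q) m = lact p (lie q m) \<oplus>\<^bsub>M\<^esub> ract (lie p m) q"


section \<open>Formal deformations\<close>

text \<open>A formal power series is represented by its sequence of coefficients.\<close>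

definition series_ring :: "('r, 'k) ring_scheme \<Rightarrow> (nat \<Rightarrow> 'r) ring" where
  "series_ring R =
    \<lparr>carrier = UNIV \<rightarrow> carrier R,
     monoid.mult = (\<lambda>f g n. \<Oplus>\<^bsub>R\<^esub>i\<in>{..n}. f i \<otimes>\<^bsub>R\<^esub> g (n - i)),
     monoid.one = (\<lambda>n. if n = 0 then \<one>\<^bsub>R\<^esub> else \<zero>\<^bsub>R\<^esub>),
     ring.zero = (\<lambda>n. \<zero>\<^bsub>R\<^esub>),
     ring.add = (\<lambda>f g n. f n \<oplus>\<^bsub>R\<^esub> g n)\<rparr>"

text \<open>\<open>A[[\<nu>]]\<close> with its standard \<open>R[[\<nu>]]\<close>-module structure, and with \<open>star\<close> as product
  and \<open>e\<close> as unit element. (The unit of a deformation need not be the constant series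
  \<open>1\<close>.)\<close>

definition star_algebra ::
  "('r, 'a, 'm) module_scheme \<Rightarrow> ((nat \<Rightarrow> 'a) \<Rightarrow> (nat \<Rightarrow> 'a) \<Rightarrow> (nat \<Rightarrow> 'a)) \<Rightarrow> (nat \<Rightarrow> 'a)
    \<Rightarrow> (nat \<Rightarrow> 'r, nat \<Rightarrow> 'a) module" where
  "star_algebra A star e =
    \<lparr>carrier = UNIV \<rightarrow> carrier A,
     monoid.mult = star,
     monoid.one = e,
     ring.zero = (\<lambda>n. \<zero>\<^bsub>A\<^esub>),
     ring.add = (\<lambda>F G n. F n \<oplus>\<^bsub>A\<^esub> G n),
     module.smult = (\<lambda>f F n. \<Oplus>\<^bsub>A\<^esub>i\<in>{..n}. f i \<odot>\<^bsub>A\<^esub> F (n - i))\<rparr>"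

definition const_series :: "('a, 'm) ring_scheme \<Rightarrow> 'a \<Rightarrow> nat \<Rightarrow> 'a" where
  "const_series A a = (\<lambda>n. if n = 0 then a else \<zero>\<^bsub>A\<^esub>)"

locale formal_deformation =
  assoc_algebra R A + S: assoc_algebra "series_ring R" "star_algebra A star e"
  for R :: "('r, 'k) ring_scheme" (structure) and A :: "('r, 'a, 'm) module_scheme" (structure)
    and star :: "(nat \<Rightarrow> 'a) \<Rightarrow> (nat \<Rightarrow> 'a) \<Rightarrow> (nat \<Rightarrow> 'a)" and e :: "nat \<Rightarrow> 'a" +
  assumes star_classical_limit: "\<lbrakk>a \<in> carrier A; b \<in> carrier A\<rbrakk> \<Longrightarrow>
    star (const_series A a) (const_series A b) 0 = a \<otimes>\<^bsub>A\<^esub> b"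

text \<open>\<open>star_coeff A star i a b\<close> is \<open>(a, b)\<^sub>i\<close> and \<open>star_bracket A star i a b\<close> is \<open>{a, b}\<^sub>i\<close>.\<close>

definition star_coeff ::
  "('a, 'm) ring_scheme \<Rightarrow> ((nat \<Rightarrow> 'a) \<Rightarrow> (nat \<Rightarrow> 'a) \<Rightarrow> (nat \<Rightarrow> 'a)) \<Rightarrow> nat \<Rightarrow> 'a \<Rightarrow> 'a \<Rightarrow> 'a" where
  "star_coeff A star i a b = star (const_series A a) (const_series A b) i"

definition star_bracket ::
  "('a, 'm) ring_scheme \<Rightarrow> ((nat \<Rightarrow> 'a) \<Rightarrow> (nat \<Rightarrow> 'a) \<Rightarrow> (nat \<Rightarrow> 'a)) \<Rightarrow> nat \<Rightarrow> 'a \<Rightarrow> 'a \<Rightarrow> 'a" where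
  "star_bracket A star i a b = star_coeff A star i a b \<ominus>\<^bsub>A\<^esub> star_coeff A star i b a"

definition commutator :: "('a, 'm) ring_scheme \<Rightarrow> 'a \<Rightarrow> 'a \<Rightarrow> 'a" where
  "commutator A a b = a \<otimes>\<^bsub>A\<^esub> b \<ominus>\<^bsub>A\<^esub> b \<otimes>\<^bsub>A\<^esub> a"

definition ring_center :: "('a, 'm) ring_scheme \<Rightarrow> 'a set" where
  "ring_center A = {z \<in> carrier A. \<forall>x \<in> carrier A. z \<otimes>\<^bsub>A\<^esub> x = x \<otimes>\<^bsub>A\<^esub> z}"


section \<open>The Poisson algebras associated to a deformation\<close>

text \<open>\<open>H_nu\<close> is the Poisson algebra \<open>Z(A) + \<nu> A[[\<nu>]]\<close>. Division by \<open>\<nu>\<close> in its bracket is the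
  shift of coefficients: the constant term of the commutator of two elements of \<open>H_nu\<close>
  vanishes.\<close>

definition H_nu ::
  "('r, 'a, 'm) module_scheme \<Rightarrow> ((nat \<Rightarrow> 'a) \<Rightarrow> (nat \<Rightarrow> 'a) \<Rightarrow> (nat \<Rightarrow> 'a)) \<Rightarrow> (nat \<Rightarrow> 'a)
    \<Rightarrow> ('r, nat \<Rightarrow> 'a) poisson" where
  "H_nu A star e =
    \<lparr>carrier = {F \<in> UNIV \<rightarrow> carrier A. F 0 \<in> ring_center A},
     monoid.mult = star,
     monoid.one = e,
     ring.zero = (\<lambda>n. \<zero>\<^bsub>A\<^esub>),
     ring.add = (\<lambda>F G n. F n \<oplus>\<^bsub>A\<^esub> G n),
     module.smult = (\<lambda>r F n. r \<odot>\<^bsub>A\<^esub> F n),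
     bracket = (\<lambda>F G n. star F G (Suc n) \<ominus>\<^bsub>A\<^esub> star G F (Suc n))\<rparr>"

text \<open>The quotient of \<open>H_nu\<close> by \<open>\<nu>\<^sup>2 A[[\<nu>]]\<close>, realised on \<open>Z(A) \<times> A\<close> through the coefficients
  of \<open>\<nu>\<^sup>0\<close> and \<open>\<nu>\<^sup>1\<close>; see the truncation lemmas below.\<close>

definition ZA_poisson ::
  "('r, 'a, 'm) module_scheme \<Rightarrow> ((nat \<Rightarrow> 'a) \<Rightarrow> (nat \<Rightarrow> 'a) \<Rightarrow> (nat \<Rightarrow> 'a)) \<Rightarrow> (nat \<Rightarrow> 'a)
    \<Rightarrow> ('r, 'a \<times> 'a) poisson" where
  "ZA_poisson A star e =
    \<lparr>carrier = ring_center A \<times> carrier A,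
     monoid.mult = (\<lambda>(a, a1) (b, b1).
       (a \<otimes>\<^bsub>A\<^esub> b, a \<otimes>\<^bsub>A\<^esub> b1 \<oplus>\<^bsub>A\<^esub> a1 \<otimes>\<^bsub>A\<^esub> b \<oplus>\<^bsub>A\<^esub> star_coeff A star 1 a b)),
     monoid.one = (e 0, e 1),
     ring.zero = (\<zero>\<^bsub>A\<^esub>, \<zero>\<^bsub>A\<^esub>),
     ring.add = (\<lambda>(a, a1) (b, b1). (a \<oplus>\<^bsub>A\<^esub> b, a1 \<oplus>\<^bsub>A\<^esub> b1)),
     module.smult = (\<lambda>r (a, a1). (r \<odot>\<^bsub>A\<^esub> a, r \<odot>\<^bsub>A\<^esub> a1)),
     bracket = (\<lambda>(a, a1) (b, b1).
       (star_bracket A star 1 a b,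
        star_bracket A star 2 a b \<oplus>\<^bsub>A\<^esub> star_bracket A star 1 a1 b
          \<oplus>\<^bsub>A\<^esub> star_bracket A star 1 a b1 \<oplus>\<^bsub>A\<^esub> commutator A a1 b1))\<rparr>"

text \<open>\<open>\<Pi>(A)\<close>, i.e. the quotient of \<open>H_nu\<close> by \<open>\<nu> H_nu\<close>: the second components are additive cosets of the center, and the operations are
  those of \<open>ZA_poisson\<close> read modulo the center. As in \<open>rcoset_mult\<close>, the union over
  all representatives replaces a choice of representatives.\<close>

definition Pi_poisson ::
  "('r, 'a, 'm) module_scheme \<Rightarrow> ((nat \<Rightarrow> 'a) \<Rightarrow> (nat \<Rightarrow> 'a) \<Rightarrow> (nat \<Rightarrow> 'a)) \<Rightarrow> (nat \<Rightarrow> 'a)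
    \<Rightarrow> ('r, 'a \<times> 'a set) poisson" where
  "Pi_poisson A star e =
    \<lparr>carrier = ring_center A \<times> (a_rcosets\<^bsub>A\<^esub> (ring_center A)),
     monoid.mult = (\<lambda>(a, X) (b, Y).
       (a \<otimes>\<^bsub>A\<^esub> b,
        \<Union>a1\<in>X. \<Union>b1\<in>Y. ring_center A +>\<^bsub>A\<^esub>
          (a \<otimes>\<^bsub>A\<^esub> b1 \<oplus>\<^bsub>A\<^esub> a1 \<otimes>\<^bsub>A\<^esub> b \<oplus>\<^bsub>A\<^esub> star_coeff A star 1 a b))),
     monoid.one = (e 0, ring_center A +>\<^bsub>A\<^esub> e 1),
     ring.zero = (\<zero>\<^bsub>A\<^esub>, ring_center A),
     ring.add = (\<lambda>(a, X) (b, Y). (a \<oplus>\<^bsub>A\<^esub> b, X <+>\<^bsub>A\<^esub> Y)),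
     module.smult = (\<lambda>r (a, X). (r \<odot>\<^bsub>A\<^esub> a, \<Union>a1\<in>X. ring_center A +>\<^bsub>A\<^esub> (r \<odot>\<^bsub>A\<^esub> a1))),
     bracket = (\<lambda>(a, X) (b, Y).
       (star_bracket A star 1 a b,
        \<Union>a1\<in>X. \<Union>b1\<in>Y. ring_center A +>\<^bsub>A\<^esub>
          (star_bracket A star 2 a b \<oplus>\<^bsub>A\<^esub> star_bracket A star 1 a1 b
            \<oplus>\<^bsub>A\<^esub> star_bracket A star 1 a b1 \<oplus>\<^bsub>A\<^esub> commutator A a1 b1)))\<rparr>"


text \<open>The following lemmas justify the explicit formulas in \<open>ZA_poisson\<close>: the coefficients of
  \<open>\<nu>\<^sup>0\<close> and \<open>\<nu>\<^sup>1\<close> define a surjective morphism from \<open>H_nu\<close>, with kernel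
  \<open>\<nu>\<^sup>2 A[[\<nu>]]\<close>.\<close>

definition truncation :: "(nat \<Rightarrow> 'a) \<Rightarrow> 'a \<times> 'a" where
  "truncation F = (F 0, F 1)"

context formal_deformation
begin

definition series_shift :: "(nat \<Rightarrow> 'a) \<Rightarrow> nat \<Rightarrow> 'a" where
  "series_shift F = (\<lambda>n. case n of 0 \<Rightarrow> \<zero>\<^bsub>A\<^esub> | Suc k \<Rightarrow> F k)"

definition series_var where
  "series_var = (\<lambda>n. if n = 1 then \<one>\<^bsub>R\<^esub> else \<zero>\<^bsub>R\<^esub>)"

lemma series_shift_eq_smult:
  assumes "F \<in> UNIV \<rightarrow> carrier A"
  shows "series_shift F = series_var \<odot>\<^bsub>star_algebra A star e\<^esub> F"
proof
  fix n
  have F: "F k \<in> carrier A" for k using assms by auto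
  show "series_shift F n = (series_var \<odot>\<^bsub>star_algebra A star e\<^esub> F) n"
  proof (cases n)
    case 0
    then show ?thesis using F by (simp add: series_shift_def series_var_def star_algebra_def)
  next
    case (Suc k)
    have "(\<Oplus>\<^bsub>A\<^esub>i\<in>{..n}. series_var i \<odot>\<^bsub>A\<^esub> F (n - i)) =
        (\<Oplus>\<^bsub>A\<^esub>i\<in>{..n}. if 1 = i then F (n - i) else \<zero>\<^bsub>A\<^esub>)"
      using F by (intro A.finsum_cong') (auto simp: series_var_def)
    also have "\<dots> = F (n - 1)"
      using F Suc by (subst A.finsum_singleton) auto
    finally show ?thesis using Suc by (simp add: series_shift_def star_algebra_def)
  qed
qed

lemma star_algebra_simps:
  "carrier (star_algebra A star e) = UNIV \<rightarrow> carrier A"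
  "F \<otimes>\<^bsub>star_algebra A star e\<^esub> G = star F G"
  "F \<oplus>\<^bsub>star_algebra A star e\<^esub> G = (\<lambda>n. F n \<oplus>\<^bsub>A\<^esub> G n)"
  by (simp_all add: star_algebra_def)

lemma star_closed:
  "\<lbrakk>F \<in> UNIV \<rightarrow> carrier A; G \<in> UNIV \<rightarrow> carrier A\<rbrakk> \<Longrightarrow> star F G n \<in> carrier A"
  using S.A.m_closed[unfolded star_algebra_simps, of F G] by auto

lemma const_series_closed: "a \<in> carrier A \<Longrightarrow> const_series A a \<in> UNIV \<rightarrow> carrier A"
  by (auto simp: const_series_def)

lemma series_shift_closed: "F \<in> UNIV \<rightarrow> carrier A \<Longrightarrow> series_shift F \<in> UNIV \<rightarrow> carrier A"
  by (fastforce simp: series_shift_def split: nat.split)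

lemma series_var_closed: "series_var \<in> carrier (series_ring R)"
  by (auto simp: series_var_def series_ring_def)

lemma star_shift_left:
  assumes "F \<in> UNIV \<rightarrow> carrier A" "G \<in> UNIV \<rightarrow> carrier A"
  shows "star (series_shift F) G = series_shift (star F G)"
proof -
  have "star F G \<in> UNIV \<rightarrow> carrier A" using assms star_closed by auto
  then show ?thesis
    using S.smult_mult_left[OF series_var_closed, of F G] assms
    by (simp add: series_shift_eq_smult star_algebra_simps(1,2))
qed

lemma star_shift_right:
  assumes "F \<in> UNIV \<rightarrow> carrier A" "G \<in> UNIV \<rightarrow> carrier A"
  shows "star F (series_shift G) = series_shift (star F G)"
proof -
  have "star F G \<in> UNIV \<rightarrow> carrier A" using assms star_closed by auto
  then show ?thesis
    using S.smult_mult_right[OF series_var_closed, of F G] assms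
    by (simp add: series_shift_eq_smult star_algebra_simps(1,2))
qed

lemma series_decomp:
  assumes "F \<in> UNIV \<rightarrow> carrier A"
  shows "F = (\<lambda>n. const_series A (F 0) n \<oplus>\<^bsub>A\<^esub> series_shift (\<lambda>k. F (Suc k)) n)"
proof
  fix n
  have "F k \<in> carrier A" for k using assms by auto
  then show "F n = const_series A (F 0) n \<oplus>\<^bsub>A\<^esub> series_shift (\<lambda>k. F (Suc k)) n"
    by (cases n) (auto simp: const_series_def series_shift_def)
qed

lemma star_decomp:
  assumes F: "F \<in> UNIV \<rightarrow> carrier A" and G: "G \<in> UNIV \<rightarrow> carrier A"
  shows "star F G n = star_coeff A star n (F 0) (G 0)
    \<oplus>\<^bsub>A\<^esub> series_shift (star (const_series A (F 0)) (\<lambda>k. G (Suc k))) n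
    \<oplus>\<^bsub>A\<^esub> series_shift (star (\<lambda>k. F (Suc k)) G) n"
proof -
  let ?c = "const_series A (F 0)" and ?d = "const_series A (G 0)"
  let ?F = "\<lambda>k. F (Suc k)" and ?G = "\<lambda>k. G (Suc k)"
  have cl: "?c \<in> UNIV \<rightarrow> carrier A" "?d \<in> UNIV \<rightarrow> carrier A"
    "?F \<in> UNIV \<rightarrow> carrier A" "?G \<in> UNIV \<rightarrow> carrier A"
    using F G by (auto intro!: const_series_closed simp: const_series_def)
  note sh = series_shift_closed[OF cl(3)] series_shift_closed[OF cl(4)]
  have "star F G n = star (\<lambda>n. ?c n \<oplus>\<^bsub>A\<^esub> series_shift ?F n) G n"
    by (subst series_decomp[OF F, symmetric]) simp
  also have "\<dots> = star ?c G n \<oplus>\<^bsub>A\<^esub> series_shift (star ?F G) n"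
    using S.A.l_distr[unfolded star_algebra_simps, OF cl(1) sh(1) G] star_shift_left[OF cl(3) G]
    by (simp add: fun_eq_iff)
  also have "star ?c G n = star ?c (\<lambda>n. ?d n \<oplus>\<^bsub>A\<^esub> series_shift ?G n) n"
    by (subst series_decomp[OF G, symmetric]) simp
  also have "\<dots> = star ?c ?d n \<oplus>\<^bsub>A\<^esub> series_shift (star ?c ?G) n"
    using S.A.r_distr[unfolded star_algebra_simps, OF cl(2) sh(2) cl(1)] star_shift_right[OF cl(1,4)]
    by (simp add: fun_eq_iff)
  finally show ?thesis by (simp add: star_coeff_def)
qed

lemma star_coeff_closed:
  "\<lbrakk>a \<in> carrier A; b \<in> carrier A\<rbrakk> \<Longrightarrow> star_coeff A star i a b \<in> carrier A"
  by (simp add: star_coeff_def star_closed const_series_closed)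

lemma star_expansion:
  assumes F: "F \<in> UNIV \<rightarrow> carrier A" and G: "G \<in> UNIV \<rightarrow> carrier A"
  shows "star F G 0 = F 0 \<otimes>\<^bsub>A\<^esub> G 0"
    and "star F G 1 = F 0 \<otimes>\<^bsub>A\<^esub> G 1 \<oplus>\<^bsub>A\<^esub> F 1 \<otimes>\<^bsub>A\<^esub> G 0 \<oplus>\<^bsub>A\<^esub> star_coeff A star 1 (F 0) (G 0)"
    and "star F G 2 = star_coeff A star 2 (F 0) (G 0)
      \<oplus>\<^bsub>A\<^esub> (star_coeff A star 1 (F 0) (G 1) \<oplus>\<^bsub>A\<^esub> F 0 \<otimes>\<^bsub>A\<^esub> G 2)
      \<oplus>\<^bsub>A\<^esub> (star_coeff A star 1 (F 1) (G 0) \<oplus>\<^bsub>A\<^esub> F 1 \<otimes>\<^bsub>A\<^esub> G 1 \<oplus>\<^bsub>A\<^esub> F 2 \<otimes>\<^bsub>A\<^esub> G 0)"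
proof -
  have zero: "star X Y 0 = X 0 \<otimes>\<^bsub>A\<^esub> Y 0"
    if "X \<in> UNIV \<rightarrow> carrier A" "Y \<in> UNIV \<rightarrow> carrier A" for X Y
  proof -
    have "X 0 \<in> carrier A" "Y 0 \<in> carrier A" using that by auto
    then show ?thesis
      using star_decomp[OF that, of 0] star_classical_limit[of "X 0" "Y 0"]
      by (simp add: series_shift_def star_coeff_def)
  qed
  have one: "star X Y (Suc 0) =
      star_coeff A star (Suc 0) (X 0) (Y 0) \<oplus>\<^bsub>A\<^esub> X 0 \<otimes>\<^bsub>A\<^esub> Y (Suc 0) \<oplus>\<^bsub>A\<^esub> X (Suc 0) \<otimes>\<^bsub>A\<^esub> Y 0"
    if XY: "X \<in> UNIV \<rightarrow> carrier A" "Y \<in> UNIV \<rightarrow> carrier A" for X Y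
  proof -
    have "const_series A (X 0) \<in> UNIV \<rightarrow> carrier A" "(\<lambda>k. Y (Suc k)) \<in> UNIV \<rightarrow> carrier A"
      "(\<lambda>k. X (Suc k)) \<in> UNIV \<rightarrow> carrier A"
      using XY by (auto simp: const_series_def)
    then show ?thesis
      using star_decomp[OF XY, of "Suc 0"] XY
      by (simp add: series_shift_def zero) (simp add: const_series_def)
  qed
  have cl: "F k \<in> carrier A" "G k \<in> carrier A" for k using F G by auto
  show "star F G 0 = F 0 \<otimes>\<^bsub>A\<^esub> G 0" by (rule zero[OF F G])
  show "star F G 1 = F 0 \<otimes>\<^bsub>A\<^esub> G 1 \<oplus>\<^bsub>A\<^esub> F 1 \<otimes>\<^bsub>A\<^esub> G 0 \<oplus>\<^bsub>A\<^esub> star_coeff A star 1 (F 0) (G 0)"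
    using one[OF F G] cl star_coeff_closed[of "F 0" "G 0" "Suc 0"] by (simp add: A.a_ac)
  have c: "const_series A (F 0) \<in> UNIV \<rightarrow> carrier A" "(\<lambda>k. G (Suc k)) \<in> UNIV \<rightarrow> carrier A"
    "(\<lambda>k. F (Suc k)) \<in> UNIV \<rightarrow> carrier A"
    using F G by (auto simp: const_series_def)
  have "star (const_series A (F 0)) (\<lambda>k. G (Suc k)) (Suc 0) =
      star_coeff A star (Suc 0) (F 0) (G 1) \<oplus>\<^bsub>A\<^esub> F 0 \<otimes>\<^bsub>A\<^esub> G 2"
    using one[OF c(1,2)] cl star_coeff_closed[of "F 0" "G (Suc 0)" "Suc 0"]
    by (simp add: const_series_def numeral_2_eq_2)
  moreover have "star (\<lambda>k. F (Suc k)) G (Suc 0) =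
      star_coeff A star (Suc 0) (F 1) (G 0) \<oplus>\<^bsub>A\<^esub> F 1 \<otimes>\<^bsub>A\<^esub> G 1 \<oplus>\<^bsub>A\<^esub> F 2 \<otimes>\<^bsub>A\<^esub> G 0"
    using one[OF c(3) G] by (simp add: numeral_2_eq_2)
  ultimately show "star F G 2 = star_coeff A star 2 (F 0) (G 0)
      \<oplus>\<^bsub>A\<^esub> (star_coeff A star 1 (F 0) (G 1) \<oplus>\<^bsub>A\<^esub> F 0 \<otimes>\<^bsub>A\<^esub> G 2)
      \<oplus>\<^bsub>A\<^esub> (star_coeff A star 1 (F 1) (G 0) \<oplus>\<^bsub>A\<^esub> F 1 \<otimes>\<^bsub>A\<^esub> G 1 \<oplus>\<^bsub>A\<^esub> F 2 \<otimes>\<^bsub>A\<^esub> G 0)"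
    using star_decomp[OF F G, of 2] by (simp add: series_shift_def numeral_2_eq_2)
qed

lemma truncation_image: "truncation ` carrier (H_nu A star e) = carrier (ZA_poisson A star e)"
proof
  show "truncation ` carrier (H_nu A star e) \<subseteq> carrier (ZA_poisson A star e)"
    by (auto simp: truncation_def H_nu_def ZA_poisson_def)
  show "carrier (ZA_poisson A star e) \<subseteq> truncation ` carrier (H_nu A star e)"
  proof
    fix x assume "x \<in> carrier (ZA_poisson A star e)"
    then obtain a b where x: "x = (a, b)" and ab: "a \<in> ring_center A" "b \<in> carrier A"
      by (auto simp: ZA_poisson_def)
    let ?F = "\<lambda>n::nat. if n = 0 then a else if n = 1 then b else \<zero>\<^bsub>A\<^esub>"
    have "?F \<in> carrier (H_nu A star e)" using ab by (auto simp: H_nu_def ring_center_def)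
    moreover have "truncation ?F = x" by (simp add: truncation_def x)
    ultimately show "x \<in> truncation ` carrier (H_nu A star e)" by blast
  qed
qed

lemma truncation_kernel:
  "truncation F = \<zero>\<^bsub>ZA_poisson A star e\<^esub> \<longleftrightarrow> F 0 = \<zero>\<^bsub>A\<^esub> \<and> F 1 = \<zero>\<^bsub>A\<^esub>"
  by (simp add: truncation_def ZA_poisson_def)

lemma truncation_one: "truncation \<one>\<^bsub>H_nu A star e\<^esub> = \<one>\<^bsub>ZA_poisson A star e\<^esub>"
  by (simp add: truncation_def ZA_poisson_def H_nu_def)

lemma truncation_add:
  "truncation (F \<oplus>\<^bsub>H_nu A star e\<^esub> G) = truncation F \<oplus>\<^bsub>ZA_poisson A star e\<^esub> truncation G"
  by (simp add: truncation_def ZA_poisson_def H_nu_def)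

lemma truncation_smult:
  "truncation (r \<odot>\<^bsub>H_nu A star e\<^esub> F) = r \<odot>\<^bsub>ZA_poisson A star e\<^esub> truncation F"
  by (simp add: truncation_def ZA_poisson_def H_nu_def)

lemma truncation_mult:
  assumes "F \<in> carrier (H_nu A star e)" "G \<in> carrier (H_nu A star e)"
  shows "truncation (F \<otimes>\<^bsub>H_nu A star e\<^esub> G) = truncation F \<otimes>\<^bsub>ZA_poisson A star e\<^esub> truncation G"
  using assms star_expansion(1,2)[of F G]
  by (simp add: truncation_def ZA_poisson_def H_nu_def)

lemma truncation_bracket:
  assumes "F \<in> carrier (H_nu A star e)" "G \<in> carrier (H_nu A star e)"
  shows "truncation (bracket (H_nu A star e) F G) =
    bracket (ZA_poisson A star e) (truncation F) (truncation G)"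
proof -
  have FG: "F \<in> UNIV \<rightarrow> carrier A" "G \<in> UNIV \<rightarrow> carrier A"
    and Z: "F 0 \<in> ring_center A" "G 0 \<in> ring_center A"
    using assms by (auto simp: H_nu_def)
  then have cl: "F k \<in> carrier A" "G k \<in> carrier A" for k by auto
  note sc = star_coeff_closed[OF cl(1) cl(1)] star_coeff_closed[OF cl(1) cl(2)]
    star_coeff_closed[OF cl(2) cl(1)] star_coeff_closed[OF cl(2) cl(2)]
  have comm: "G k \<otimes>\<^bsub>A\<^esub> F 0 = F 0 \<otimes>\<^bsub>A\<^esub> G k" "G 0 \<otimes>\<^bsub>A\<^esub> F k = F k \<otimes>\<^bsub>A\<^esub> G 0" for k
    using Z cl by (auto simp: ring_center_def)
  have minus: "x \<ominus>\<^bsub>A\<^esub> y = x \<oplus>\<^bsub>A\<^esub> \<ominus>\<^bsub>A\<^esub> y" for x y by (simp add: a_minus_def)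
  have "star F G 1 \<ominus>\<^bsub>A\<^esub> star G F 1 = star_bracket A star 1 (F 0) (G 0)"
    unfolding star_expansion(2)[OF FG] star_expansion(2)[OF FG(2,1)] comm star_bracket_def minus
    using cl sc by algebra
  moreover have "star F G 2 \<ominus>\<^bsub>A\<^esub> star G F 2 =
      star_bracket A star 2 (F 0) (G 0) \<oplus>\<^bsub>A\<^esub> star_bracket A star 1 (F 1) (G 0)
        \<oplus>\<^bsub>A\<^esub> star_bracket A star 1 (F 0) (G 1) \<oplus>\<^bsub>A\<^esub> commutator A (F 1) (G 1)"
    unfolding star_expansion(3)[OF FG] star_expansion(3)[OF FG(2,1)] comm star_bracket_def
      commutator_def minus
    using cl sc by algebra
  ultimately show ?thesis
    by (simp add: truncation_def ZA_poisson_def H_nu_def numeral_2_eq_2)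
qed

end

end

theory Submission
  imports Defs
begin

text \<open>The identities of the Poisson algebra \<open>H_nu\<close> hold after multiplication by powers of \<open>\<nu>\<close>,
  where they become commutator identities of the star product, and \<open>\<nu>\<close> can be cancelled. They
  pass to the surjective images \<open>Z(A) \<times> A\<close> and \<open>\<Pi>(A)\<close>. The copy \<open>{0} \<times> A\<close> of \<open>A\<close> is a
  Poisson ideal of the former, hence a Poisson module; its actions depend on \<open>a\<^sub>1\<close> only modulo
  the center, so they descend to \<open>\<Pi>(A)\<close>.\<close>

text \<open>Checking the Poisson axioms on the explicit formulas of \<open>ZA_poisson\<close> would
  require relations between the first and second order coefficients of \<open>star\<close>, and for
  \<open>Pi_poisson\<close> control over representatives as well. Treating the targets as bare
  records and deriving their axioms from a surjection that respects the operations avoids the former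
  and reduces the latter to well-definedness. What is not formal is closure: nothing in the
  definition of the bracket of \<open>H_nu\<close> shows that its constant term is central. The
  module over \<open>\<Pi>(A)\<close> cannot come from an ideal of \<open>\<Pi>(A)\<close> in the
  same way, since \<open>{0} \<times> A\<close> has shrunk to \<open>{0} \<times> A/Z(A)\<close>
  there. It has to be descended from \<open>Z(A) \<times> A\<close>, and this is possible because
  \<open>(0, z)\<close> with \<open>z\<close> central acts by zero on
  \<open>{0} \<times> A\<close>.\<close>

section \<open>Transport of Poisson structures and modules along surjections\<close>

locale poisson_epimorphism = poisson_algebra R P
  for R (structure) and P :: "('r, 'p, 'm) poisson_scheme" (structure) +
  fixes Q :: "('r, 'q, 'n) poisson_scheme" (structure) and h :: "'p \<Rightarrow> 'q"
  assumes h_image: "h ` carrier P = carrier Q"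
    and h_zero: "h \<zero>\<^bsub>P\<^esub> = \<zero>\<^bsub>Q\<^esub>"
    and h_one: "h \<one>\<^bsub>P\<^esub> = \<one>\<^bsub>Q\<^esub>"
    and h_add: "\<lbrakk>x \<in> carrier P; y \<in> carrier P\<rbrakk> \<Longrightarrow> h (x \<oplus>\<^bsub>P\<^esub> y) = h x \<oplus>\<^bsub>Q\<^esub> h y"
    and h_smult: "\<lbrakk>r \<in> carrier R; x \<in> carrier P\<rbrakk> \<Longrightarrow> h (r \<odot>\<^bsub>P\<^esub> x) = r \<odot>\<^bsub>Q\<^esub> h x"
    and h_mult: "\<lbrakk>x \<in> carrier P; y \<in> carrier P\<rbrakk> \<Longrightarrow> h (x \<otimes>\<^bsub>P\<^esub> y) = h x \<otimes>\<^bsub>Q\<^esub> h y"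
    and h_bracket:
      "\<lbrakk>x \<in> carrier P; y \<in> carrier P\<rbrakk> \<Longrightarrow> h (bracket P x y) = bracket Q (h x) (h y)"
begin

text \<open>Read from right to left, the homomorphism laws fold an expression in images
  \<open>h p\<close> into a single \<open>h\<close> of an expression in \<open>P\<close>, where the
  axioms are available.\<close>

lemmas h_reverse = h_zero[symmetric] h_one[symmetric] h_add[symmetric] h_smult[symmetric]
  h_mult[symmetric] h_bracket[symmetric]

lemma image_abelian_group: "abelian_group Q"
proof (rule abelian_groupI)
  fix x assume "x \<in> carrier Q"
  then obtain p where p: "p \<in> carrier P" "x = h p" by (auto simp: h_image[symmetric])
  have "h (\<ominus>\<^bsub>P\<^esub> p) \<oplus>\<^bsub>Q\<^esub> h p = \<zero>\<^bsub>Q\<^esub>"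
    using p by (simp add: h_reverse A.l_neg)
  then show "\<exists>y\<in>carrier Q. y \<oplus>\<^bsub>Q\<^esub> x = \<zero>\<^bsub>Q\<^esub>"
    using p by (auto simp: h_image[symmetric])
qed (auto simp: h_image[symmetric] h_reverse A.a_ac)

lemma image_poisson_algebra: "poisson_algebra R Q"
proof -
  have "monoid Q"
    by (rule monoidI) (auto simp: h_image[symmetric] h_reverse A.m_assoc)
  then have "ring Q"
    by (intro ringI image_abelian_group)
      (auto simp: h_image[symmetric] h_reverse A.l_distr A.r_distr)
  moreover have "module R Q"
    by (intro moduleI image_abelian_group R.is_cring)
      (auto simp: h_image[symmetric] h_reverse smult_l_distr smult_r_distr smult_assoc1)
  moreover have "assoc_algebra_axioms R Q"
    by unfold_locales
      (auto simp: h_image[symmetric] h_reverse smult_mult_left smult_mult_right)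
  moreover have "poisson_algebra_axioms R Q"
    by unfold_locales
      (auto simp: h_image[symmetric] h_reverse bracket_closed bracket_add_left bracket_add_right
        bracket_smult_left bracket_smult_right bracket_alternating bracket_jacobi bracket_leibniz)
  ultimately show ?thesis
    by (simp add: poisson_algebra_def assoc_algebra_def)
qed

text \<open>The hypotheses on the primed actions say that the actions of \<open>P\<close> factor
  through \<open>h\<close>. The primed actions may thus be built with arbitrary representatives, as
  long as agreement on images is shown.\<close>

lemma image_poisson_module:
  assumes "poisson_module R P M lact ract lie"
    and lact': "\<And>p m. \<lbrakk>p \<in> carrier P; m \<in> carrier M\<rbrakk> \<Longrightarrow> lact' (h p) m = lact p m"
    and ract': "\<And>p m. \<lbrakk>p \<in> carrier P; m \<in> carrier M\<rbrakk> \<Longrightarrow> ract' m (h p) = ract m p"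
    and lie': "\<And>p m. \<lbrakk>p \<in> carrier P; m \<in> carrier M\<rbrakk> \<Longrightarrow> lie' (h p) m = lie p m"
  shows "poisson_module R Q M lact' ract' lie'"
proof -
  interpret N: poisson_module R P M lact ract lie by fact
  interpret Q: poisson_algebra R Q by (rule image_poisson_algebra)
  note closed = bracket_closed N.lact_closed N.ract_closed N.lie_closed
  show ?thesis
    by unfold_locales
      (auto simp: h_image[symmetric] h_reverse lact' ract' lie' closed
        N.lact_add_left N.lact_add_right N.lact_smult_left N.lact_smult_right N.lact_one N.lact_mult
        N.ract_add_left N.ract_add_right N.ract_smult_left N.ract_smult_right N.ract_one N.ract_mult
        N.lact_ract N.lie_add_left N.lie_add_right N.lie_smult_left N.lie_smult_right
        N.lie_bracket N.lie_lact N.lie_ract N.lie_mult)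
qed

end

section \<open>Poisson ideals as Poisson modules\<close>

context poisson_algebra
begin

lemma bracket_antisym:
  assumes "a \<in> carrier P" "b \<in> carrier P"
  shows "bracket P b a = \<ominus>\<^bsub>P\<^esub> bracket P a b"
proof -
  have "bracket P b a \<oplus>\<^bsub>P\<^esub> bracket P a b = bracket P (a \<oplus>\<^bsub>P\<^esub> b) (a \<oplus>\<^bsub>P\<^esub> b)"
    using assms
    by (subst bracket_add_left)
      (simp_all add: bracket_add_right bracket_alternating bracket_closed A.a_comm)
  also have "\<dots> = \<zero>\<^bsub>P\<^esub>" using assms by (simp add: bracket_alternating)
  finally show ?thesis using assms by (intro A.minus_equality[symmetric]) (simp_all add: bracket_closed)
qed

lemma bracket_minus_right:
  assumes "a \<in> carrier P" "b \<in> carrier P"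
  shows "bracket P a (\<ominus>\<^bsub>P\<^esub> b) = \<ominus>\<^bsub>P\<^esub> bracket P a b"
  using bracket_smult_right[of "\<ominus> \<one>" a b] assms
  by (simp add: smult_l_minus bracket_closed)

text \<open>The Jacobi identity in the shape of the Lie module law \<open>lie_bracket\<close>;
  antisymmetry moves the arguments into place.\<close>

lemma bracket_bracket_left:
  assumes "a \<in> carrier P" "b \<in> carrier P" "c \<in> carrier P"
  shows "bracket P (bracket P a b) c =
    bracket P a (bracket P b c) \<ominus>\<^bsub>P\<^esub> bracket P b (bracket P a c)"
proof -
  note cl = assms bracket_closed
  have "bracket P a (bracket P b c) \<ominus>\<^bsub>P\<^esub> bracket P b (bracket P a c)
      \<ominus>\<^bsub>P\<^esub> bracket P (bracket P a b) c = \<zero>\<^bsub>P\<^esub>"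
    using bracket_jacobi[OF assms] bracket_antisym[of a c] bracket_antisym[of "bracket P a b" c]
    by (simp add: cl bracket_minus_right A.minus_eq)
  then have "\<ominus>\<^bsub>P\<^esub> (\<ominus>\<^bsub>P\<^esub> bracket P (bracket P a b) c) =
      bracket P a (bracket P b c) \<ominus>\<^bsub>P\<^esub> bracket P b (bracket P a c)"
    by (intro A.minus_equality) (simp_all add: cl A.minus_eq)
  then show ?thesis by (simp add: cl)
qed

text \<open>Antisymmetry carries the Leibniz rule to the first argument. The product need not
  commute, so the order of the factors matters; it is the order demanded by
  \<open>lie_mult\<close>.\<close>

lemma bracket_mult_left:
  assumes "a \<in> carrier P" "b \<in> carrier P" "c \<in> carrier P"
  shows "bracket P (a \<otimes>\<^bsub>P\<^esub> b) c = a \<otimes>\<^bsub>P\<^esub> bracket P b c \<oplus>\<^bsub>P\<^esub> bracket P a c \<otimes>\<^bsub>P\<^esub> b"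
proof -
  have "bracket P (a \<otimes>\<^bsub>P\<^esub> b) c = \<ominus>\<^bsub>P\<^esub> (bracket P c a \<otimes>\<^bsub>P\<^esub> b \<oplus>\<^bsub>P\<^esub> a \<otimes>\<^bsub>P\<^esub> bracket P c b)"
    using assms by (simp add: bracket_antisym[of c "a \<otimes>\<^bsub>P\<^esub> b"] bracket_leibniz)
  also have "\<dots> = a \<otimes>\<^bsub>P\<^esub> \<ominus>\<^bsub>P\<^esub> bracket P c b \<oplus>\<^bsub>P\<^esub> \<ominus>\<^bsub>P\<^esub> bracket P c a \<otimes>\<^bsub>P\<^esub> b"
    using assms
    by (simp add: bracket_closed A.minus_add A.l_minus A.r_minus A.a_comm)
  finally show ?thesis
    using assms by (simp add: bracket_antisym[of c a] bracket_antisym[of c b])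
qed

text \<open>Under the embedding \<open>j\<close>, each module law becomes an identity between
  elements of \<open>P\<close> itself, so the Poisson algebra laws prove it and injectivity brings
  it back to \<open>M\<close>.\<close>

lemma ideal_poisson_module:
  assumes "module R M"
    and inj: "inj_on j (carrier M)"
    and j_closed: "\<And>m. m \<in> carrier M \<Longrightarrow> j m \<in> carrier P"
    and j_add: "\<And>m n. \<lbrakk>m \<in> carrier M; n \<in> carrier M\<rbrakk> \<Longrightarrow> j (m \<oplus>\<^bsub>M\<^esub> n) = j m \<oplus>\<^bsub>P\<^esub> j n"
    and j_smult: "\<And>r m. \<lbrakk>r \<in> carrier R; m \<in> carrier M\<rbrakk> \<Longrightarrow> j (r \<odot>\<^bsub>M\<^esub> m) = r \<odot>\<^bsub>P\<^esub> j m"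
    and lact_closed: "\<And>p m. \<lbrakk>p \<in> carrier P; m \<in> carrier M\<rbrakk> \<Longrightarrow> lact p m \<in> carrier M"
    and ract_closed: "\<And>p m. \<lbrakk>p \<in> carrier P; m \<in> carrier M\<rbrakk> \<Longrightarrow> ract m p \<in> carrier M"
    and lie_closed: "\<And>p m. \<lbrakk>p \<in> carrier P; m \<in> carrier M\<rbrakk> \<Longrightarrow> lie p m \<in> carrier M"
    and j_lact: "\<And>p m. \<lbrakk>p \<in> carrier P; m \<in> carrier M\<rbrakk> \<Longrightarrow> j (lact p m) = p \<otimes>\<^bsub>P\<^esub> j m"
    and j_ract: "\<And>p m. \<lbrakk>p \<in> carrier P; m \<in> carrier M\<rbrakk> \<Longrightarrow> j (ract m p) = j m \<otimes>\<^bsub>P\<^esub> p"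
    and j_lie: "\<And>p m. \<lbrakk>p \<in> carrier P; m \<in> carrier M\<rbrakk> \<Longrightarrow> j (lie p m) = bracket P p (j m)"
  shows "poisson_module R P M lact ract lie"
proof -
  interpret N: module R M by fact
  \<comment> \<open>Subtraction enters through \<open>lie_bracket\<close>. Writing a negative as a
    multiple by the scalar \<open>\<ominus> \<one>\<close> reduces it to
    \<open>j_smult\<close>.\<close>
  have j_minus: "j (m \<ominus>\<^bsub>M\<^esub> n) = j m \<ominus>\<^bsub>P\<^esub> j n" if mn: "m \<in> carrier M" "n \<in> carrier M" for m n
  proof -
    have "j (\<ominus>\<^bsub>M\<^esub> n) = j (\<ominus> \<one> \<odot>\<^bsub>M\<^esub> n)"
      using mn by (simp add: N.smult_l_minus)
    also have "\<dots> = \<ominus>\<^bsub>P\<^esub> j n"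
      using mn by (simp add: j_smult smult_l_minus j_closed)
    finally show ?thesis using mn by (simp add: a_minus_def j_add)
  qed
  note j = j_add j_smult j_lact j_ract j_lie j_minus
  note cl = j_closed lact_closed ract_closed lie_closed bracket_closed
  note eq = inj_onD[OF inj]
  show ?thesis
    \<comment> \<open>Closure goals go to the first alternative; the equations are tested after
      applying \<open>j\<close>.\<close>
    by (unfold_locales;
      (simp add: cl; fail |
       rule eq;
        simp add: j cl A.l_distr A.r_distr A.m_assoc smult_mult_left smult_mult_right
          bracket_add_left bracket_add_right bracket_smult_left bracket_smult_right
          bracket_bracket_left bracket_leibniz bracket_mult_left A.a_comm; fail))
qed

end

section \<open>Cosets, commutators and the center of a ring\<close>

context abelian_subgroup
begin

text \<open>Collapses the unions over representatives in \<open>Pi_poisson\<close>: if moving the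
  argument by \<open>H\<close> moves the value of \<open>f\<close> only within one coset, then all
  cosets in the union coincide, and \<open>a\<close> itself makes the index set nonempty.\<close>

lemma UN_a_r_coset:
  assumes a: "a \<in> carrier G" and f: "f a \<in> carrier G"
    and step: "\<And>z. z \<in> H \<Longrightarrow> f (z \<oplus>\<^bsub>G\<^esub> a) \<in> H +>\<^bsub>G\<^esub> f a"
  shows "(\<Union>x \<in> H +>\<^bsub>G\<^esub> a. H +>\<^bsub>G\<^esub> f x) = H +>\<^bsub>G\<^esub> f a"
proof -
  have "H +>\<^bsub>G\<^esub> f x = H +>\<^bsub>G\<^esub> f a" if x: "x \<in> H +>\<^bsub>G\<^esub> a" for x
  proof -
    obtain z where "z \<in> H" "x = z \<oplus>\<^bsub>G\<^esub> a" using x by (auto simp: a_r_coset_def')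
    then have "f x \<in> H +>\<^bsub>G\<^esub> f a" using step by simp
    then show ?thesis using a_repr_independence[OF _ f a_subgroup] by simp
  qed
  moreover have "a \<in> H +>\<^bsub>G\<^esub> a" using a by (rule a_rcos_self)
  ultimately show ?thesis by blast
qed

end

lemma (in ring) commutator_closed:
  "\<lbrakk>a \<in> carrier R; b \<in> carrier R\<rbrakk> \<Longrightarrow> commutator R a b \<in> carrier R"
  by (simp add: commutator_def)

lemma (in ring) commutator_alternating: "a \<in> carrier R \<Longrightarrow> commutator R a a = \<zero>"
  by (simp add: commutator_def a_minus_def r_neg)

lemma (in ring) commutator_add_left:
  "\<lbrakk>a \<in> carrier R; b \<in> carrier R; c \<in> carrier R\<rbrakk> \<Longrightarrow>
    commutator R (a \<oplus> b) c = commutator R a c \<oplus> commutator R b c"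
  unfolding commutator_def a_minus_def by algebra

lemma (in ring) commutator_add_right:
  "\<lbrakk>a \<in> carrier R; b \<in> carrier R; c \<in> carrier R\<rbrakk> \<Longrightarrow>
    commutator R a (b \<oplus> c) = commutator R a b \<oplus> commutator R a c"
  unfolding commutator_def a_minus_def by algebra

lemma (in ring) commutator_mult_right:
  "\<lbrakk>a \<in> carrier R; b \<in> carrier R; c \<in> carrier R\<rbrakk> \<Longrightarrow>
    commutator R a (b \<otimes> c) = commutator R a b \<otimes> c \<oplus> b \<otimes> commutator R a c"
  unfolding commutator_def a_minus_def by algebra

lemma (in ring) commutator_jacobi:
  "\<lbrakk>a \<in> carrier R; b \<in> carrier R; c \<in> carrier R\<rbrakk> \<Longrightarrow>
    commutator R a (commutator R b c) \<oplus> commutator R b (commutator R c a)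
      \<oplus> commutator R c (commutator R a b) = \<zero>"
  unfolding commutator_def a_minus_def by algebra

lemma (in ring) commutator_commutator_left:
  "\<lbrakk>a \<in> carrier R; b \<in> carrier R; c \<in> carrier R\<rbrakk> \<Longrightarrow>
    commutator R (commutator R a b) c =
      commutator R a (commutator R b c) \<ominus> commutator R b (commutator R a c)"
  unfolding commutator_def a_minus_def by algebra

lemma (in ring) ring_center_closed: "z \<in> ring_center R \<Longrightarrow> z \<in> carrier R"
  by (simp add: ring_center_def)

lemma (in ring) ring_center_commute:
  "\<lbrakk>z \<in> ring_center R; x \<in> carrier R\<rbrakk> \<Longrightarrow> x \<otimes> z = z \<otimes> x"
  by (simp add: ring_center_def)

lemma (in ring) ring_center_zero: "\<zero> \<in> ring_center R"
  by (simp add: ring_center_def)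

lemma (in ring) ring_center_one: "\<one> \<in> ring_center R"
  by (simp add: ring_center_def)

lemma (in ring) ring_center_add:
  "\<lbrakk>a \<in> ring_center R; b \<in> ring_center R\<rbrakk> \<Longrightarrow> a \<oplus> b \<in> ring_center R"
  by (auto simp: ring_center_def l_distr r_distr)

lemma (in ring) ring_center_minus:
  "a \<in> ring_center R \<Longrightarrow> \<ominus> a \<in> ring_center R"
  by (auto simp: ring_center_def l_minus r_minus)

lemma (in ring) ring_center_mult:
  assumes a: "a \<in> ring_center R" and b: "b \<in> ring_center R"
  shows "a \<otimes> b \<in> ring_center R"
proof -
  note cl = ring_center_closed[OF a] ring_center_closed[OF b]
  have "a \<otimes> b \<otimes> x = x \<otimes> (a \<otimes> b)" if x: "x \<in> carrier R" for x
  proof -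
    have "a \<otimes> b \<otimes> x = a \<otimes> (x \<otimes> b)"
      using cl x by (simp add: m_assoc ring_center_commute[OF b x])
    also have "\<dots> = a \<otimes> x \<otimes> b" using cl x by (simp add: m_assoc)
    also have "\<dots> = x \<otimes> (a \<otimes> b)"
      using cl x by (simp add: m_assoc flip: ring_center_commute[OF a x])
    finally show ?thesis .
  qed
  then show ?thesis using cl by (simp add: ring_center_def)
qed

lemma (in ring) ring_center_iff_commutator:
  "z \<in> ring_center R \<longleftrightarrow> z \<in> carrier R \<and> (\<forall>x \<in> carrier R. commutator R z x = \<zero>)"
proof -
  have "a \<ominus> b = \<zero> \<longleftrightarrow> a = b" if "a \<in> carrier R" "b \<in> carrier R" for a b
    using that by (metis a_minus_def a_inv_closed minus_equality minus_minus r_neg)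
  then show ?thesis by (auto simp: ring_center_def commutator_def)
qed

context assoc_algebra
begin

lemma ring_center_smult:
  "\<lbrakk>r \<in> carrier R; z \<in> ring_center A\<rbrakk> \<Longrightarrow> r \<odot>\<^bsub>A\<^esub> z \<in> ring_center A"
  by (auto simp: ring_center_def smult_mult_left smult_mult_right)

lemma smult_minus_distr:
  "\<lbrakk>r \<in> carrier R; a \<in> carrier A; b \<in> carrier A\<rbrakk> \<Longrightarrow>
    r \<odot>\<^bsub>A\<^esub> (a \<ominus>\<^bsub>A\<^esub> b) = r \<odot>\<^bsub>A\<^esub> a \<ominus>\<^bsub>A\<^esub> r \<odot>\<^bsub>A\<^esub> b"
  by (simp add: a_minus_def smult_r_distr smult_r_minus)

lemma commutator_smult_left:
  "\<lbrakk>r \<in> carrier R; a \<in> carrier A; b \<in> carrier A\<rbrakk> \<Longrightarrow>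
    commutator A (r \<odot>\<^bsub>A\<^esub> a) b = r \<odot>\<^bsub>A\<^esub> commutator A a b"
  by (simp add: commutator_def smult_mult_left smult_mult_right smult_minus_distr)

lemma commutator_smult_right:
  "\<lbrakk>r \<in> carrier R; a \<in> carrier A; b \<in> carrier A\<rbrakk> \<Longrightarrow>
    commutator A a (r \<odot>\<^bsub>A\<^esub> b) = r \<odot>\<^bsub>A\<^esub> commutator A a b"
  by (simp add: commutator_def smult_mult_left smult_mult_right smult_minus_distr)

end

section \<open>The Poisson algebra \<open>H_nu\<close>\<close>

context formal_deformation
begin

abbreviation S where "S \<equiv> star_algebra A star e"
abbreviation H where "H \<equiv> H_nu A star e"

text \<open>Subtraction in \<open>S\<close> is derived from its additive group rather than defined
  coefficientwise; uniqueness of additive inverses identifies the two.\<close>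

lemma S_minus:
  assumes F: "F \<in> carrier S" and G: "G \<in> carrier S"
  shows "(F \<ominus>\<^bsub>S\<^esub> G) n = F n \<ominus>\<^bsub>A\<^esub> G n"
proof -
  have cl: "F k \<in> carrier A" "G k \<in> carrier A" for k
    using F G by (auto simp: star_algebra_def)
  have "(\<lambda>k. \<ominus>\<^bsub>A\<^esub> G k) = \<ominus>\<^bsub>S\<^esub> G"
    using cl G by (intro S.A.minus_equality[symmetric]) (auto simp: star_algebra_def A.l_neg)
  then show ?thesis by (simp add: a_minus_def star_algebra_simps(3) fun_eq_iff)
qed

text \<open>The unit \<open>e\<close> may have higher order terms, but the product is undeformed in
  order 0, so comparing constant terms in \<open>e \<star> 1 = 1\<close> fixes its constant term.
  This puts \<open>e\<close> into \<open>H\<close>.\<close>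

lemma S_unit_0: "e 0 = \<one>\<^bsub>A\<^esub>"
proof -
  have e: "e \<in> UNIV \<rightarrow> carrier A" using S.A.one_closed by (simp add: star_algebra_def)
  have c: "const_series A \<one>\<^bsub>A\<^esub> \<in> UNIV \<rightarrow> carrier A" by (rule const_series_closed) simp
  have "star e (const_series A \<one>\<^bsub>A\<^esub>) = const_series A \<one>\<^bsub>A\<^esub>"
    using S.A.l_one[of "const_series A \<one>\<^bsub>A\<^esub>"] c by (simp add: star_algebra_def)
  moreover have "e 0 \<in> carrier A" using e by auto
  ultimately show ?thesis
    using star_expansion(1)[OF e c] by (simp add: const_series_def)
qed

text \<open>Restriction of scalars: \<open>H\<close> is a module over \<open>R\<close> but
  \<open>S\<close> is one over \<open>R[[\<nu>]]\<close>, and constant series embed the former ring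
  into the latter.\<close>

lemma const_series_smult:
  assumes r: "r \<in> carrier R" and F: "F \<in> UNIV \<rightarrow> carrier A"
  shows "const_series R r \<odot>\<^bsub>S\<^esub> F = (\<lambda>n. r \<odot>\<^bsub>A\<^esub> F n)"
proof
  fix n
  have F': "F k \<in> carrier A" for k using F by auto
  have "(\<Oplus>\<^bsub>A\<^esub>i\<in>{..n}. const_series R r i \<odot>\<^bsub>A\<^esub> F (n - i)) =
      (\<Oplus>\<^bsub>A\<^esub>i\<in>{..n}. if 0 = i then r \<odot>\<^bsub>A\<^esub> F (n - i) else \<zero>\<^bsub>A\<^esub>)"
    using r F' by (intro A.finsum_cong') (auto simp: const_series_def)
  also have "\<dots> = r \<odot>\<^bsub>A\<^esub> F n"
    using r F' by (subst A.finsum_singleton) auto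
  finally show "(const_series R r \<odot>\<^bsub>S\<^esub> F) n = r \<odot>\<^bsub>A\<^esub> F n"
    by (simp add: star_algebra_def)
qed

lemma const_series_carrier: "r \<in> carrier R \<Longrightarrow> const_series R r \<in> carrier (series_ring R)"
  by (auto simp: const_series_def series_ring_def)

lemma H_carrier_iff: "F \<in> carrier H \<longleftrightarrow> F \<in> carrier S \<and> F 0 \<in> ring_center A"
  by (simp add: H_nu_def star_algebra_def)

lemma H_simps:
  "F \<otimes>\<^bsub>H\<^esub> G = F \<otimes>\<^bsub>S\<^esub> G" "F \<oplus>\<^bsub>H\<^esub> G = F \<oplus>\<^bsub>S\<^esub> G" "\<one>\<^bsub>H\<^esub> = \<one>\<^bsub>S\<^esub>" "\<zero>\<^bsub>H\<^esub> = \<zero>\<^bsub>S\<^esub>"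
  by (simp_all add: H_nu_def star_algebra_def)

lemma H_smult:
  "\<lbrakk>r \<in> carrier R; F \<in> carrier S\<rbrakk> \<Longrightarrow> r \<odot>\<^bsub>H\<^esub> F = const_series R r \<odot>\<^bsub>S\<^esub> F"
  by (simp add: H_nu_def star_algebra_simps(1) const_series_smult)

lemma S_closed_nth: "F \<in> carrier S \<Longrightarrow> F n \<in> carrier A"
  by (auto simp: star_algebra_def)

lemma H_subset: "F \<in> carrier H \<Longrightarrow> F \<in> carrier S"
  by (simp add: H_carrier_iff)

lemma S_mult_0: "\<lbrakk>F \<in> carrier S; G \<in> carrier S\<rbrakk> \<Longrightarrow> (F \<otimes>\<^bsub>S\<^esub> G) 0 = F 0 \<otimes>\<^bsub>A\<^esub> G 0"
  by (simp add: star_algebra_def star_expansion(1))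

lemma H_add_closed: "\<lbrakk>F \<in> carrier H; G \<in> carrier H\<rbrakk> \<Longrightarrow> F \<oplus>\<^bsub>S\<^esub> G \<in> carrier H"
  by (simp add: H_carrier_iff) (simp add: star_algebra_def A.ring_center_add)

lemma H_mult_closed: "\<lbrakk>F \<in> carrier H; G \<in> carrier H\<rbrakk> \<Longrightarrow> F \<otimes>\<^bsub>S\<^esub> G \<in> carrier H"
  by (simp add: H_carrier_iff S_mult_0 A.ring_center_mult)

lemma H_minus_closed: "F \<in> carrier H \<Longrightarrow> \<ominus>\<^bsub>S\<^esub> F \<in> carrier H"
  using S_minus[of "\<zero>\<^bsub>S\<^esub>" F 0]
  by (simp add: H_carrier_iff a_minus_def)
    (simp add: star_algebra_def a_minus_def A.ring_center_minus A.ring_center_closed)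

lemma H_zero_closed: "\<zero>\<^bsub>S\<^esub> \<in> carrier H"
  by (simp add: H_carrier_iff) (simp add: star_algebra_def A.ring_center_zero)

lemma H_one_closed: "\<one>\<^bsub>S\<^esub> \<in> carrier H"
  by (simp add: H_carrier_iff) (simp add: star_algebra_def S_unit_0 A.ring_center_one)

lemma H_smult_closed:
  "\<lbrakk>r \<in> carrier R; F \<in> carrier H\<rbrakk> \<Longrightarrow> const_series R r \<odot>\<^bsub>S\<^esub> F \<in> carrier H"
  by (simp add: H_carrier_iff const_series_carrier)
    (simp add: star_algebra_simps(1) const_series_smult ring_center_smult)

lemmas H_closed = H_add_closed H_mult_closed H_minus_closed H_zero_closed H_one_closed
  H_smult_closed

lemma H_abelian_group: "abelian_group H"
proof (rule abelian_groupI)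
  fix F assume "F \<in> carrier H"
  then show "\<exists>G\<in>carrier H. G \<oplus>\<^bsub>H\<^esub> F = \<zero>\<^bsub>H\<^esub>"
    by (auto simp: H_simps H_subset S.A.l_neg intro!: bexI[of _ "\<ominus>\<^bsub>S\<^esub> F"] H_closed)
qed (auto simp: H_simps H_closed H_subset S.A.a_ac)

lemma const_series_add:
  assumes "r \<in> carrier R" "s \<in> carrier R"
  shows "const_series R (r \<oplus> s) = const_series R r \<oplus>\<^bsub>series_ring R\<^esub> const_series R s"
  using assms by (auto simp: const_series_def series_ring_def fun_eq_iff)

lemma const_series_one: "const_series R \<one> = \<one>\<^bsub>series_ring R\<^esub>"
  by (simp add: const_series_def series_ring_def)

lemma H_assoc_algebra: "assoc_algebra R H"
proof -
  have "monoid H"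
    by (rule monoidI) (auto simp: H_simps H_closed H_subset S.A.m_assoc)
  then have "ring H"
    by (intro ringI H_abelian_group) (auto simp: H_simps H_subset S.A.l_distr S.A.r_distr)
  moreover have "module R H"
  proof (intro moduleI H_abelian_group R.is_cring)
    \<comment> \<open>Here a product of scalars would become a convolution of constant series;
      compared coefficient by coefficient, the law is just that of \<open>A\<close>.\<close>
    fix r s F assume *: "r \<in> carrier R" "s \<in> carrier R" "F \<in> carrier H"
    then have F: "F n \<in> carrier A" for n by (simp add: H_subset S_closed_nth)
    show "(r \<otimes> s) \<odot>\<^bsub>H\<^esub> F = r \<odot>\<^bsub>H\<^esub> (s \<odot>\<^bsub>H\<^esub> F)"
      using * F by (simp add: H_nu_def smult_assoc1)
  qed (auto simp: H_smult H_simps H_closed H_subset S.smult_l_distr S.smult_r_distr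
      const_series_add const_series_one const_series_carrier)
  moreover have "assoc_algebra_axioms R H"
    by unfold_locales
      (auto simp: H_smult H_simps H_closed H_subset S.smult_mult_left S.smult_mult_right
        const_series_carrier)
  ultimately show ?thesis by (simp add: assoc_algebra_def)
qed

text \<open>Multiplication by \<nu> shifts the coefficients, so coefficient \<open>n\<close> is
  recovered at position \<open>Suc n\<close>.\<close>

lemma series_var_smult_cancel:
  assumes "series_var \<odot>\<^bsub>S\<^esub> F = series_var \<odot>\<^bsub>S\<^esub> G" "F \<in> carrier S" "G \<in> carrier S"
  shows "F = G"
proof
  fix n
  have "series_shift F = series_shift G"
    using assms by (simp add: series_shift_eq_smult star_algebra_simps(1))
  then have "series_shift F (Suc n) = series_shift G (Suc n)" by simp
  then show "F n = G n" by (simp add: series_shift_def)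
qed

lemma H_bracket_closed_S: "\<lbrakk>F \<in> carrier S; G \<in> carrier S\<rbrakk> \<Longrightarrow> bracket H F G \<in> carrier S"
  by (auto simp: H_nu_def star_algebra_def star_closed)

text \<open>One argument with central constant term already makes the constant term of the
  commutator vanish, so division by \<nu> loses nothing. That \<open>G\<close> may be any series is
  essential for the closure of \<open>H\<close> under the bracket and for iterated brackets.\<close>

lemma series_var_H_bracket:
  assumes F: "F \<in> carrier H" and G: "G \<in> carrier S"
  shows "series_var \<odot>\<^bsub>S\<^esub> bracket H F G = commutator S F G"
proof -
  have FS: "F \<in> carrier S" using F by (rule H_subset)
  have comm: "commutator S F G n = star F G n \<ominus>\<^bsub>A\<^esub> star G F n" for n
    using S_minus[OF S.A.m_closed[OF FS G] S.A.m_closed[OF G FS], of n]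
    by (simp add: commutator_def star_algebra_simps(2))
  have "star F G 0 = star G F 0"
    using S_mult_0[OF FS G] S_mult_0[OF G FS] F S_closed_nth[OF G, of 0]
    by (simp add: star_algebra_simps(2) H_carrier_iff A.ring_center_commute)
  moreover have "star F G 0 \<in> carrier A"
    using FS G star_closed by (simp add: star_algebra_simps(1))
  \<comment> \<open>At index 0 both sides are zero; above it, the shift undoes the
    \<open>Suc\<close> in the definition of the bracket.\<close>
  ultimately have "series_shift (bracket H F G) n = commutator S F G n" for n
    by (cases n) (auto simp: series_shift_def H_nu_def comm a_minus_def A.r_neg)
  then show ?thesis
    using H_bracket_closed_S[OF FS G]
    by (simp add: fun_eq_iff series_shift_eq_smult[symmetric] star_algebra_simps(1))
qed

lemma series_var_smult_0: "F \<in> carrier S \<Longrightarrow> (series_var \<odot>\<^bsub>S\<^esub> F) 0 = \<zero>\<^bsub>A\<^esub>"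
  using fun_cong[OF series_shift_eq_smult[of F], of 0]
  by (simp add: star_algebra_simps(1) series_shift_def)

text \<open>The commutator of \<open>[F, G]\<^sub>\<nu>\<close> with any \<open>K\<close> is divisible by \<open>\<nu>\<close>, by the Jacobi identity of
  the star commutator; hence the constant term of \<open>[F, G]\<^sub>\<nu>\<close> is central.\<close>

lemma H_bracket_closed:
  assumes F: "F \<in> carrier H" and G: "G \<in> carrier H"
  shows "bracket H F G \<in> carrier H"
proof -
  note FS = H_subset[OF F] and GS = H_subset[OF G] and \<nu> = series_var_closed
  note BS = H_bracket_closed_S[OF FS GS]
  have "commutator A (bracket H F G 0) x = \<zero>\<^bsub>A\<^esub>" if x: "x \<in> carrier A" for x
  proof -
    \<comment> \<open>The element \<open>x\<close> is arbitrary, so \<open>K\<close> need not lie in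
      \<open>H\<close>; its brackets with \<open>F\<close> and \<open>G\<close> still satisfy
      \<open>series_var_H_bracket\<close>.\<close>
    define K where "K = const_series A x"
    have K: "K \<in> carrier S" "K 0 = x"
      using const_series_closed[OF x] by (auto simp: K_def star_algebra_simps(1) const_series_def)
    let ?FGK = "bracket H F (bracket H G K)" and ?GFK = "bracket H G (bracket H F K)"
    note cl = H_bracket_closed_S[OF FS K(1)] H_bracket_closed_S[OF GS K(1)]
      H_bracket_closed_S[OF FS H_bracket_closed_S[OF GS K(1)]]
      H_bracket_closed_S[OF GS H_bracket_closed_S[OF FS K(1)]]
    have "series_var \<odot>\<^bsub>S\<^esub> commutator S (bracket H F G) K =
        commutator S (commutator S F G) K"
      using BS K(1) \<nu> by (simp add: S.commutator_smult_left flip: series_var_H_bracket[OF F GS])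
    also have "\<dots> = series_var \<odot>\<^bsub>S\<^esub> (series_var \<odot>\<^bsub>S\<^esub> ?FGK \<ominus>\<^bsub>S\<^esub> series_var \<odot>\<^bsub>S\<^esub> ?GFK)"
      using FS GS K(1) cl \<nu>
      by (simp add: S.A.commutator_commutator_left S.commutator_smult_right S.smult_minus_distr
          series_var_H_bracket[OF F cl(2)] series_var_H_bracket[OF G cl(1)]
          S.A.commutator_closed
          flip: series_var_H_bracket[OF F K(1)] series_var_H_bracket[OF G K(1)])
    \<comment> \<open>Only the outer factor \<nu> is cancelled. The inner one stays and annihilates
      the constant term.\<close>
    finally have eq: "commutator S (bracket H F G) K =
        series_var \<odot>\<^bsub>S\<^esub> ?FGK \<ominus>\<^bsub>S\<^esub> series_var \<odot>\<^bsub>S\<^esub> ?GFK"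
      using BS K(1) cl \<nu> by - (rule series_var_smult_cancel, simp_all add: S.A.commutator_closed)
    have "commutator S (bracket H F G) K 0 = \<zero>\<^bsub>A\<^esub>"
      unfolding eq using cl \<nu> by (simp add: S_minus series_var_smult_0 A.minus_eq)
    then show ?thesis
      using BS K by (simp add: commutator_def S_minus S_mult_0)
  qed
  then show ?thesis
    using BS by (simp add: H_carrier_iff A.ring_center_iff_commutator S_closed_nth)
qed

lemma H_poisson_algebra: "poisson_algebra R H"
proof -
  note \<nu> = series_var_closed
  note cl = H_bracket_closed H_bracket_closed_S H_subset H_closed S.A.commutator_closed
    const_series_carrier
  have "poisson_algebra_axioms R H"
  proof
    fix F G K assume FGK: "F \<in> carrier H" "G \<in> carrier H" "K \<in> carrier H"
    \<comment> \<open>Since \<nu> times the bracket is the commutator, a candidate \<open>W\<close>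
      for the bracket need only be compared with the commutator after multiplication by
      \<nu>.\<close>
    have cancel: "bracket H X Y = W"
      if "X \<in> carrier H" "Y \<in> carrier S" "W \<in> carrier S" "commutator S X Y = series_var \<odot>\<^bsub>S\<^esub> W"
      for X Y W
      using that by - (rule series_var_smult_cancel, simp_all add: series_var_H_bracket cl)
    show "bracket H F G \<in> carrier H" using FGK by (simp add: cl)
    show "bracket H (F \<oplus>\<^bsub>H\<^esub> G) K = bracket H F K \<oplus>\<^bsub>H\<^esub> bracket H G K"
      unfolding H_simps using FGK
      by - (rule cancel, auto simp: cl \<nu> S.smult_r_distr series_var_H_bracket S.A.commutator_add_left)
    show "bracket H F (G \<oplus>\<^bsub>H\<^esub> K) = bracket H F G \<oplus>\<^bsub>H\<^esub> bracket H F K"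
      unfolding H_simps using FGK
      by - (rule cancel, auto simp: cl \<nu> S.smult_r_distr series_var_H_bracket S.A.commutator_add_right)
    show "bracket H F F = \<zero>\<^bsub>H\<^esub>"
      unfolding H_simps using FGK
      by - (rule cancel, auto simp: cl \<nu> S.A.commutator_alternating)
    show "bracket H F (G \<otimes>\<^bsub>H\<^esub> K) = bracket H F G \<otimes>\<^bsub>H\<^esub> K \<oplus>\<^bsub>H\<^esub> G \<otimes>\<^bsub>H\<^esub> bracket H F K"
      unfolding H_simps using FGK
      by - (rule cancel, auto simp: cl \<nu> S.smult_r_distr S.A.commutator_mult_right series_var_H_bracket
          S.smult_mult_left[symmetric, of _ "bracket H F G" K]
          S.smult_mult_right[symmetric, of _ G "bracket H F K"])
    \<comment> \<open>The Jacobi identity nests two brackets, so it becomes a commutator identity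
      only after multiplication by the square of \<nu>, and \<nu> is cancelled twice.\<close>
    have twice: "series_var \<odot>\<^bsub>S\<^esub> (series_var \<odot>\<^bsub>S\<^esub> bracket H X (bracket H Y W)) =
        commutator S X (commutator S Y W)"
      if "X \<in> carrier H" "Y \<in> carrier H" "W \<in> carrier H" for X Y W
      using that
      by (simp add: cl \<nu> series_var_H_bracket flip: S.commutator_smult_right)
    show "bracket H F (bracket H G K) \<oplus>\<^bsub>H\<^esub> bracket H G (bracket H K F)
        \<oplus>\<^bsub>H\<^esub> bracket H K (bracket H F G) = \<zero>\<^bsub>H\<^esub>"
      unfolding H_simps using FGK
      by - (rule series_var_smult_cancel, rule series_var_smult_cancel,
        auto simp: cl \<nu> S.smult_r_distr twice S.A.commutator_jacobi)
  next
    \<comment> \<open>Compatibility with scalars is read off the coefficients directly, from the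
      bilinearity of \<open>star\<close> over \<open>R\<close>, without passing through commutators
      in \<open>S\<close>.\<close>
    fix r F G assume *: "r \<in> carrier R" "F \<in> carrier H" "G \<in> carrier H"
    then have "F n \<in> carrier A" "G n \<in> carrier A" for n by (auto simp: cl S_closed_nth)
    moreover have "star F G n \<in> carrier A" "star G F n \<in> carrier A" for n
      using * by (auto intro!: star_closed simp: H_nu_def)
    moreover have "star (\<lambda>n. r \<odot>\<^bsub>A\<^esub> F n) G = (\<lambda>n. r \<odot>\<^bsub>A\<^esub> star F G n)"
        "star F (\<lambda>n. r \<odot>\<^bsub>A\<^esub> G n) = (\<lambda>n. r \<odot>\<^bsub>A\<^esub> star F G n)"
      if "F \<in> carrier H" "G \<in> carrier H" for F G
      using assoc_algebra.smult_mult_left[OF H_assoc_algebra *(1) that]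
        assoc_algebra.smult_mult_right[OF H_assoc_algebra *(1) that]
      by (simp_all add: H_nu_def)
    ultimately show "bracket H (r \<odot>\<^bsub>H\<^esub> F) G = r \<odot>\<^bsub>H\<^esub> bracket H F G"
      "bracket H F (r \<odot>\<^bsub>H\<^esub> G) = r \<odot>\<^bsub>H\<^esub> bracket H F G"
      using * by (simp_all add: H_nu_def smult_minus_distr)
  qed
  then show ?thesis
    by (simp add: poisson_algebra_def H_assoc_algebra)
qed

end

section \<open>The quotients \<open>Z(A) \<times> A\<close> and \<open>\<Pi>(A)\<close>\<close>

context formal_deformation
begin

abbreviation Z where "Z \<equiv> ring_center A"
abbreviation ZA where "ZA \<equiv> ZA_poisson A star e"
abbreviation PiA where "PiA \<equiv> Pi_poisson A star e"

lemma truncation_epimorphism: "poisson_epimorphism R H ZA truncation"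
proof -
  have "truncation \<zero>\<^bsub>H\<^esub> = \<zero>\<^bsub>ZA\<^esub>"
    by (simp add: truncation_kernel) (simp add: H_nu_def)
  then show ?thesis
    by (intro poisson_epimorphism.intro H_poisson_algebra poisson_epimorphism_axioms.intro)
      (simp_all add: truncation_image truncation_one truncation_add truncation_smult
        truncation_mult truncation_bracket)
qed

lemma ZA_poisson_algebra: "poisson_algebra R ZA"
  by (rule poisson_epimorphism.image_poisson_algebra[OF truncation_epimorphism])

lemma Z_abelian_subgroup: "abelian_subgroup Z A"
proof (rule abelian_subgroupI3)
  show "additive_subgroup Z A"
    by (intro additive_subgroupI A.add.subgroupI)
      (auto simp: A.ring_center_zero A.ring_center_add A.ring_center_closed
        A.ring_center_minus simp flip: a_inv_def intro: A.ring_center_zero)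
qed (rule A.is_abelian_group)

interpretation Z: abelian_subgroup Z A
  by (rule Z_abelian_subgroup)

lemma star_coeff_add:
  assumes "a \<in> carrier A" "b \<in> carrier A" "c \<in> carrier A"
  shows "star_coeff A star i (a \<oplus>\<^bsub>A\<^esub> b) c = star_coeff A star i a c \<oplus>\<^bsub>A\<^esub> star_coeff A star i b c"
    and "star_coeff A star i c (a \<oplus>\<^bsub>A\<^esub> b) = star_coeff A star i c a \<oplus>\<^bsub>A\<^esub> star_coeff A star i c b"
proof -
  have c: "const_series A x \<in> carrier S" if "x \<in> carrier A" for x
    using const_series_closed[OF that] by (simp add: star_algebra_simps(1))
  have "const_series A (a \<oplus>\<^bsub>A\<^esub> b) = const_series A a \<oplus>\<^bsub>S\<^esub> const_series A b"
    using assms by (auto simp: const_series_def star_algebra_simps(3))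
  then show "star_coeff A star i (a \<oplus>\<^bsub>A\<^esub> b) c = star_coeff A star i a c \<oplus>\<^bsub>A\<^esub> star_coeff A star i b c"
    and "star_coeff A star i c (a \<oplus>\<^bsub>A\<^esub> b) = star_coeff A star i c a \<oplus>\<^bsub>A\<^esub> star_coeff A star i c b"
    using S.A.l_distr[OF c c c, OF assms] S.A.r_distr[OF c c c, OF assms]
    by (simp_all add: star_coeff_def star_algebra_simps(2,3))
qed

lemma star_coeff_zero:
  assumes "a \<in> carrier A"
  shows "star_coeff A star i \<zero>\<^bsub>A\<^esub> a = \<zero>\<^bsub>A\<^esub>" "star_coeff A star i a \<zero>\<^bsub>A\<^esub> = \<zero>\<^bsub>A\<^esub>"
  using star_coeff_add[of "\<zero>\<^bsub>A\<^esub>" "\<zero>\<^bsub>A\<^esub>" a i] assms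
  by (simp_all add: star_coeff_closed)

lemma star_bracket_closed:
  "\<lbrakk>a \<in> carrier A; b \<in> carrier A\<rbrakk> \<Longrightarrow> star_bracket A star i a b \<in> carrier A"
  by (simp add: star_bracket_def star_coeff_closed)

lemma star_bracket_zero:
  assumes "a \<in> carrier A"
  shows "star_bracket A star i \<zero>\<^bsub>A\<^esub> a = \<zero>\<^bsub>A\<^esub>" "star_bracket A star i a \<zero>\<^bsub>A\<^esub> = \<zero>\<^bsub>A\<^esub>"
  using assms by (simp_all add: star_bracket_def star_coeff_zero A.minus_eq)

lemma star_bracket_add:
  assumes "a \<in> carrier A" "b \<in> carrier A" "c \<in> carrier A"
  shows "star_bracket A star i (a \<oplus>\<^bsub>A\<^esub> b) c = star_bracket A star i a c \<oplus>\<^bsub>A\<^esub> star_bracket A star i b c"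
    and "star_bracket A star i c (a \<oplus>\<^bsub>A\<^esub> b) = star_bracket A star i c a \<oplus>\<^bsub>A\<^esub> star_bracket A star i c b"
  using assms
  by (simp_all add: star_bracket_def star_coeff_add star_coeff_closed A.minus_eq A.minus_add A.a_ac)

lemma commutator_center:
  assumes "z \<in> Z" "a \<in> carrier A"
  shows "commutator A z a = \<zero>\<^bsub>A\<^esub>" "commutator A a z = \<zero>\<^bsub>A\<^esub>"
  using assms A.ring_center_commute[OF assms]
  by (simp_all add: commutator_def A.minus_eq A.r_neg A.ring_center_closed)

text \<open>\<open>{a, b}\<^sub>1\<close> is the first component of the bracket of
  \<open>(a, 0)\<close> and \<open>(b, 0)\<close>, so its centrality is part of the closure of
  \<open>ZA\<close>, inherited from \<open>H\<close>.\<close>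

lemma star_bracket_center:
  assumes "a \<in> Z" "b \<in> Z"
  shows "star_bracket A star 1 a b \<in> Z"
  using poisson_algebra.bracket_closed[OF ZA_poisson_algebra, of "(a, \<zero>\<^bsub>A\<^esub>)" "(b, \<zero>\<^bsub>A\<^esub>)"] assms
  by (simp add: ZA_poisson_def)

text \<open>The quotient map by \<open>{0} \<times> Z\<close>. Composed with
  \<open>truncation\<close> it is the quotient of \<open>H_nu\<close> by
  \<open>\<nu> H_nu\<close>.\<close>

definition projection :: "'a \<times> 'a \<Rightarrow> 'a \<times> 'a set" where
  "projection = (\<lambda>(a, a1). (a, Z +>\<^bsub>A\<^esub> a1))"

lemma coset_add_center:
  "\<lbrakk>z \<in> Z; x \<in> carrier A\<rbrakk> \<Longrightarrow> z \<oplus>\<^bsub>A\<^esub> x \<in> Z +>\<^bsub>A\<^esub> x"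
  by (auto simp: a_r_coset_def')

text \<open>Moving a representative by a central \<open>z\<close> changes the second component by
  \<open>a \<otimes> z\<close> or \<open>z \<otimes> b\<close>, a product of central
  elements.\<close>

lemma projection_mult:
  assumes "x \<in> carrier ZA" "y \<in> carrier ZA"
  shows "projection (x \<otimes>\<^bsub>ZA\<^esub> y) = projection x \<otimes>\<^bsub>PiA\<^esub> projection y"
proof -
  obtain a a1 b b1 where xy: "x = (a, a1)" "y = (b, b1)" by (cases x, cases y)
  have a: "a \<in> Z" "b \<in> Z" "a1 \<in> carrier A" "b1 \<in> carrier A"
    using assms by (auto simp: xy ZA_poisson_def)
  note cl = A.ring_center_closed star_coeff_closed
  let ?f = "\<lambda>a1 b1. a \<otimes>\<^bsub>A\<^esub> b1 \<oplus>\<^bsub>A\<^esub> a1 \<otimes>\<^bsub>A\<^esub> b \<oplus>\<^bsub>A\<^esub> star_coeff A star 1 a b"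
  \<comment> \<open>The inner union is collapsed for every \<open>a'\<close>, because it stands
    below the outer union over a whole coset.\<close>
  have "(\<Union>b'\<in>Z +>\<^bsub>A\<^esub> b1. Z +>\<^bsub>A\<^esub> ?f a' b') = Z +>\<^bsub>A\<^esub> ?f a' b1" if a': "a' \<in> carrier A" for a'
  proof (rule Z.UN_a_r_coset)
    fix z assume z: "z \<in> Z"
    have "?f a' (z \<oplus>\<^bsub>A\<^esub> b1) = a \<otimes>\<^bsub>A\<^esub> z \<oplus>\<^bsub>A\<^esub> ?f a' b1"
      using a z a' by (simp add: cl A.r_distr A.a_ac)
    then show "?f a' (z \<oplus>\<^bsub>A\<^esub> b1) \<in> Z +>\<^bsub>A\<^esub> ?f a' b1"
      using a z a' by (simp add: coset_add_center A.ring_center_mult cl)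
  qed (use a a' in \<open>simp_all add: cl\<close>)
  moreover have "(\<Union>a'\<in>Z +>\<^bsub>A\<^esub> a1. Z +>\<^bsub>A\<^esub> ?f a' b1) = Z +>\<^bsub>A\<^esub> ?f a1 b1"
  proof (rule Z.UN_a_r_coset)
    fix z assume z: "z \<in> Z"
    have "?f (z \<oplus>\<^bsub>A\<^esub> a1) b1 = z \<otimes>\<^bsub>A\<^esub> b \<oplus>\<^bsub>A\<^esub> ?f a1 b1"
      using a z by (simp add: cl A.l_distr A.a_ac)
    then show "?f (z \<oplus>\<^bsub>A\<^esub> a1) b1 \<in> Z +>\<^bsub>A\<^esub> ?f a1 b1"
      using a z by (simp add: coset_add_center A.ring_center_mult cl)
  qed (use a in \<open>simp_all add: cl\<close>)
  moreover have "Z +>\<^bsub>A\<^esub> a1 \<subseteq> carrier A"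
    using a by (simp add: A.a_r_coset_subset_G Z.a_subset)
  ultimately have "(\<Union>a'\<in>Z +>\<^bsub>A\<^esub> a1. \<Union>b'\<in>Z +>\<^bsub>A\<^esub> b1. Z +>\<^bsub>A\<^esub> ?f a' b') = Z +>\<^bsub>A\<^esub> ?f a1 b1"
    by (simp add: subset_iff)
  then show ?thesis
    by (simp add: projection_def xy ZA_poisson_def Pi_poisson_def)
qed

text \<open>A central shift \<open>z\<close> of a representative is invisible to the commutator and
  contributes only \<open>{a, z}\<^sub>1\<close> or \<open>{z, b}\<^sub>1\<close>, which
  \<open>star_bracket_center\<close> makes central.\<close>

lemma projection_bracket:
  assumes "x \<in> carrier ZA" "y \<in> carrier ZA"
  shows "projection (bracket ZA x y) = bracket PiA (projection x) (projection y)"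
proof -
  obtain a a1 b b1 where xy: "x = (a, a1)" "y = (b, b1)" by (cases x, cases y)
  have a: "a \<in> Z" "b \<in> Z" "a1 \<in> carrier A" "b1 \<in> carrier A"
    using assms by (auto simp: xy ZA_poisson_def)
  note cl = A.ring_center_closed star_bracket_closed A.commutator_closed
  let ?f = "\<lambda>a1 b1. star_bracket A star 2 a b \<oplus>\<^bsub>A\<^esub> star_bracket A star 1 a1 b
    \<oplus>\<^bsub>A\<^esub> star_bracket A star 1 a b1 \<oplus>\<^bsub>A\<^esub> commutator A a1 b1"
  have "(\<Union>b'\<in>Z +>\<^bsub>A\<^esub> b1. Z +>\<^bsub>A\<^esub> ?f a' b') = Z +>\<^bsub>A\<^esub> ?f a' b1" if a': "a' \<in> carrier A" for a'
  proof (rule Z.UN_a_r_coset)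
    fix z assume z: "z \<in> Z"
    have "?f a' (z \<oplus>\<^bsub>A\<^esub> b1) = star_bracket A star 1 a z \<oplus>\<^bsub>A\<^esub> ?f a' b1"
      using a z a'
      by (simp add: cl star_bracket_add A.commutator_add_right commutator_center A.a_ac
          del: One_nat_def)
    then show "?f a' (z \<oplus>\<^bsub>A\<^esub> b1) \<in> Z +>\<^bsub>A\<^esub> ?f a' b1"
      using a z a' by (simp add: coset_add_center star_bracket_center cl del: One_nat_def)
  qed (use a a' in \<open>simp_all add: cl\<close>)
  moreover have "(\<Union>a'\<in>Z +>\<^bsub>A\<^esub> a1. Z +>\<^bsub>A\<^esub> ?f a' b1) = Z +>\<^bsub>A\<^esub> ?f a1 b1"
  proof (rule Z.UN_a_r_coset)
    fix z assume z: "z \<in> Z"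
    have "?f (z \<oplus>\<^bsub>A\<^esub> a1) b1 = star_bracket A star 1 z b \<oplus>\<^bsub>A\<^esub> ?f a1 b1"
      using a z
      by (simp add: cl star_bracket_add A.commutator_add_left commutator_center A.a_ac
          del: One_nat_def)
    then show "?f (z \<oplus>\<^bsub>A\<^esub> a1) b1 \<in> Z +>\<^bsub>A\<^esub> ?f a1 b1"
      using a z by (simp add: coset_add_center star_bracket_center cl del: One_nat_def)
  qed (use a in \<open>simp_all add: cl\<close>)
  moreover have "Z +>\<^bsub>A\<^esub> a1 \<subseteq> carrier A"
    using a by (simp add: A.a_r_coset_subset_G Z.a_subset)
  ultimately have "(\<Union>a'\<in>Z +>\<^bsub>A\<^esub> a1. \<Union>b'\<in>Z +>\<^bsub>A\<^esub> b1. Z +>\<^bsub>A\<^esub> ?f a' b') = Z +>\<^bsub>A\<^esub> ?f a1 b1"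
    by (simp add: subset_iff)
  then show ?thesis
    by (simp add: projection_def xy ZA_poisson_def Pi_poisson_def)
qed

lemma projection_smult:
  assumes r: "r \<in> carrier R" and "x \<in> carrier ZA"
  shows "projection (r \<odot>\<^bsub>ZA\<^esub> x) = r \<odot>\<^bsub>PiA\<^esub> projection x"
proof -
  obtain a a1 where x: "x = (a, a1)" by (cases x)
  have a: "a1 \<in> carrier A" using assms by (auto simp: x ZA_poisson_def)
  have "(\<Union>a'\<in>Z +>\<^bsub>A\<^esub> a1. Z +>\<^bsub>A\<^esub> r \<odot>\<^bsub>A\<^esub> a') = Z +>\<^bsub>A\<^esub> r \<odot>\<^bsub>A\<^esub> a1"
    using r a
    by (intro Z.UN_a_r_coset)
      (simp_all add: smult_r_distr coset_add_center ring_center_smult A.ring_center_closed)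
  then show ?thesis
    by (simp add: projection_def x ZA_poisson_def Pi_poisson_def)
qed

lemma projection_epimorphism: "poisson_epimorphism R ZA PiA projection"
proof (intro poisson_epimorphism.intro ZA_poisson_algebra poisson_epimorphism_axioms.intro)
  show "projection ` carrier ZA = carrier PiA"
    by (force simp: projection_def ZA_poisson_def Pi_poisson_def A_RCOSETS_def')
  show "projection \<zero>\<^bsub>ZA\<^esub> = \<zero>\<^bsub>PiA\<^esub>"
    by (simp add: projection_def ZA_poisson_def Pi_poisson_def Z.a_subset)
  show "projection \<one>\<^bsub>ZA\<^esub> = \<one>\<^bsub>PiA\<^esub>"
    by (simp add: projection_def ZA_poisson_def Pi_poisson_def)
  show "projection (x \<oplus>\<^bsub>ZA\<^esub> y) = projection x \<oplus>\<^bsub>PiA\<^esub> projection y"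
    if "x \<in> carrier ZA" "y \<in> carrier ZA" for x y
    using that
    by (auto simp: projection_def ZA_poisson_def Pi_poisson_def Z.a_rcos_sum)
qed (simp_all add: projection_smult projection_mult projection_bracket)

text \<open>The products in the two orders differ by \<open>(0, {a, b}\<^sub>1)\<close>, which dies
  in the quotient by the center.\<close>

lemma projection_commute:
  assumes "x \<in> carrier ZA" "y \<in> carrier ZA"
  shows "projection (x \<otimes>\<^bsub>ZA\<^esub> y) = projection (y \<otimes>\<^bsub>ZA\<^esub> x)"
proof -
  obtain a a1 b b1 where xy: "x = (a, a1)" "y = (b, b1)" by (cases x, cases y)
  have a: "a \<in> Z" "b \<in> Z" "a1 \<in> carrier A" "b1 \<in> carrier A"
    using assms by (auto simp: xy ZA_poisson_def)
  note cl = A.ring_center_closed star_coeff_closed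
  define u where "u = b \<otimes>\<^bsub>A\<^esub> a1 \<oplus>\<^bsub>A\<^esub> b1 \<otimes>\<^bsub>A\<^esub> a \<oplus>\<^bsub>A\<^esub> star_coeff A star 1 b a"
  have u: "u \<in> carrier A" using a by (simp add: u_def cl)
  have comm: "a1 \<otimes>\<^bsub>A\<^esub> b = b \<otimes>\<^bsub>A\<^esub> a1" "b1 \<otimes>\<^bsub>A\<^esub> a = a \<otimes>\<^bsub>A\<^esub> b1" "a \<otimes>\<^bsub>A\<^esub> b = b \<otimes>\<^bsub>A\<^esub> a"
    using A.ring_center_commute[OF a(2,3)] A.ring_center_commute[OF a(1,4)]
      A.ring_center_commute[OF a(2) cl(1)[OF a(1)]] by simp_all
  have "a \<otimes>\<^bsub>A\<^esub> b1 \<oplus>\<^bsub>A\<^esub> a1 \<otimes>\<^bsub>A\<^esub> b \<oplus>\<^bsub>A\<^esub> star_coeff A star 1 a b =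
      star_bracket A star 1 a b \<oplus>\<^bsub>A\<^esub> u"
    unfolding u_def star_bracket_def comm A.minus_eq
    using a star_coeff_closed[of a b 1] star_coeff_closed[of b a 1] cl(1)[of a] cl(1)[of b]
    by algebra
  moreover have "Z +>\<^bsub>A\<^esub> (star_bracket A star 1 a b \<oplus>\<^bsub>A\<^esub> u) = Z +>\<^bsub>A\<^esub> u"
    using u a by (intro Z.a_repr_independence'[symmetric] coset_add_center star_bracket_center)
  ultimately show ?thesis
    by (simp add: projection_def xy ZA_poisson_def comm(3) flip: u_def del: One_nat_def)
qed

lemma Pi_commutative_poisson_algebra: "commutative_poisson_algebra R PiA"
proof -
  interpret proj: poisson_epimorphism R ZA PiA projection
    by (rule projection_epimorphism)
  interpret PiA: poisson_algebra R PiA by (rule proj.image_poisson_algebra)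
  have "x \<otimes>\<^bsub>PiA\<^esub> y = y \<otimes>\<^bsub>PiA\<^esub> x" if "x \<in> carrier PiA" "y \<in> carrier PiA" for x y
    using that
    by (auto simp: proj.h_image[symmetric] projection_mult[symmetric] projection_commute)
  then have "comm_monoid PiA" by (rule PiA.monoid_comm_monoidI)
  then show ?thesis
    by (simp add: commutative_poisson_algebra_def PiA.poisson_algebra_axioms)
qed

section \<open>The two Poisson module structures on \<open>A\<close>\<close>

lemma ZA_fst_zero:
  assumes "p \<in> carrier ZA" "m \<in> carrier A"
  shows "fst (p \<otimes>\<^bsub>ZA\<^esub> (\<zero>\<^bsub>A\<^esub>, m)) = \<zero>\<^bsub>A\<^esub>" "fst ((\<zero>\<^bsub>A\<^esub>, m) \<otimes>\<^bsub>ZA\<^esub> p) = \<zero>\<^bsub>A\<^esub>"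
    "fst (bracket ZA p (\<zero>\<^bsub>A\<^esub>, m)) = \<zero>\<^bsub>A\<^esub>"
  using assms by (auto simp: ZA_poisson_def A.ring_center_closed star_bracket_zero)

lemma ZA_poisson_module:
  "poisson_module R ZA A
    (\<lambda>p m. snd (p \<otimes>\<^bsub>ZA\<^esub> (\<zero>\<^bsub>A\<^esub>, m)))
    (\<lambda>m p. snd ((\<zero>\<^bsub>A\<^esub>, m) \<otimes>\<^bsub>ZA\<^esub> p))
    (\<lambda>p m. snd (bracket ZA p (\<zero>\<^bsub>A\<^esub>, m)))"
proof -
  interpret ZA: poisson_algebra R ZA by (rule ZA_poisson_algebra)
  have j: "(\<zero>\<^bsub>A\<^esub>, m) \<in> carrier ZA" if "m \<in> carrier A" for m
    using that by (simp add: ZA_poisson_def A.ring_center_zero)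
  have snd_closed: "snd x \<in> carrier A" if "x \<in> carrier ZA" for x
    using that by (auto simp: ZA_poisson_def)
  show ?thesis
  \<comment> \<open>By \<open>ZA_fst_zero\<close> every action result has first component zero, so
    applying \<open>snd\<close> and then \<open>j\<close> returns it unchanged.\<close>
  proof (rule ZA.ideal_poisson_module[where j = "\<lambda>m. (\<zero>\<^bsub>A\<^esub>, m)"])
    show "module R A" by (rule module_axioms)
    show "inj_on (\<lambda>m. (\<zero>\<^bsub>A\<^esub>, m)) (carrier A)" by (rule inj_onI) simp
  qed (simp_all add: j snd_closed ZA.bracket_closed ZA_fst_zero prod_eq_iff,
      simp_all add: ZA_poisson_def)
qed

lemma ZA_actions:
  assumes "a \<in> Z" "a1 \<in> carrier A" "b \<in> carrier A"
  shows "snd ((a, a1) \<otimes>\<^bsub>ZA\<^esub> (\<zero>\<^bsub>A\<^esub>, b)) = a \<otimes>\<^bsub>A\<^esub> b"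
    and "snd ((\<zero>\<^bsub>A\<^esub>, b) \<otimes>\<^bsub>ZA\<^esub> (a, a1)) = b \<otimes>\<^bsub>A\<^esub> a"
    and "snd (bracket ZA (a, a1) (\<zero>\<^bsub>A\<^esub>, b)) = star_bracket A star 1 a b \<oplus>\<^bsub>A\<^esub> commutator A a1 b"
  using assms
  by (simp_all add: ZA_poisson_def A.ring_center_closed star_coeff_zero star_bracket_zero
      star_bracket_closed A.commutator_closed)

text \<open>Two representatives differ by a central element, which the commutator does not see; this
  makes the Lie action of \<open>\<Pi>(A)\<close> well defined.\<close>

lemma commutator_coset:
  assumes "a1 \<in> carrier A" "b \<in> carrier A" "x \<in> Z +>\<^bsub>A\<^esub> a1"
  shows "commutator A x b = commutator A a1 b"
  using assms
  by (auto simp: a_r_coset_def' A.commutator_add_left commutator_center A.ring_center_closed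
      A.commutator_closed)

lemma Pi_poisson_module:
  "\<exists>lact ract lie.
    poisson_module R PiA A lact ract lie \<and>
    (\<forall>a \<in> Z. \<forall>a1 \<in> carrier A. \<forall>b \<in> carrier A.
       lact (a, Z +>\<^bsub>A\<^esub> a1) b = a \<otimes>\<^bsub>A\<^esub> b \<and>
       ract b (a, Z +>\<^bsub>A\<^esub> a1) = b \<otimes>\<^bsub>A\<^esub> a \<and> b \<otimes>\<^bsub>A\<^esub> a = a \<otimes>\<^bsub>A\<^esub> b \<and>
       lie (a, Z +>\<^bsub>A\<^esub> a1) b = star_bracket A star 1 a b \<oplus>\<^bsub>A\<^esub> commutator A a1 b)"
proof -
  interpret proj: poisson_epimorphism R ZA PiA projection
    by (rule projection_epimorphism)
  define lact :: "'a \<times> 'a set \<Rightarrow> 'a \<Rightarrow> 'a" where "lact = (\<lambda>(a, X) b. a \<otimes>\<^bsub>A\<^esub> b)"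
  define ract :: "'a \<Rightarrow> 'a \<times> 'a set \<Rightarrow> 'a" where "ract = (\<lambda>b (a, X). b \<otimes>\<^bsub>A\<^esub> a)"
  \<comment> \<open>Only the Lie action looks at the coset. \<open>SOME\<close> picks a
    representative, and \<open>commutator_coset\<close> shows in \<open>act\<close> that the choice
    does not matter.\<close>
  define lie where "lie = (\<lambda>(a, X) b.
    star_bracket A star 1 a b \<oplus>\<^bsub>A\<^esub> commutator A (SOME x. x \<in> X) b)"
  have act: "lact (a, Z +>\<^bsub>A\<^esub> a1) b = a \<otimes>\<^bsub>A\<^esub> b" "ract b (a, Z +>\<^bsub>A\<^esub> a1) = b \<otimes>\<^bsub>A\<^esub> a"
    "lie (a, Z +>\<^bsub>A\<^esub> a1) b = star_bracket A star 1 a b \<oplus>\<^bsub>A\<^esub> commutator A a1 b"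
    if "a1 \<in> carrier A" "b \<in> carrier A" for a a1 b
    using commutator_coset[OF that someI[of "\<lambda>x. x \<in> Z +>\<^bsub>A\<^esub> a1", OF Z.a_rcos_self[OF that(1)]]]
    by (simp_all add: lact_def ract_def lie_def)
  have carrier: "p \<in> carrier ZA \<Longrightarrow> fst p \<in> Z \<and> snd p \<in> carrier A" for p
    by (auto simp: ZA_poisson_def)
  \<comment> \<open>The formulas in \<open>act\<close> and \<open>ZA_actions\<close> agree, so the
    new actions pull back along \<open>projection\<close> to those of \<open>ZA\<close>.\<close>
  have "poisson_module R PiA A lact ract lie"
    using act ZA_actions carrier
    by (intro proj.image_poisson_module[OF ZA_poisson_module])
      (auto simp: projection_def split: prod.splits)
  then show ?thesis
    by (intro exI[of _ lact] exI[of _ ract] exI[of _ lie] conjI ballI)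
      (assumption | rule act A.ring_center_commute; assumption)+
qed

end

theorem proposition2p17:
  fixes R :: "('r, 'k) ring_scheme" (structure)
    and A :: "('r, 'a, 'm) module_scheme" (structure)
    and star :: "(nat \<Rightarrow> 'a) \<Rightarrow> (nat \<Rightarrow> 'a) \<Rightarrow> (nat \<Rightarrow> 'a)" and e :: "nat \<Rightarrow> 'a"
  assumes "formal_deformation R A star e"
  defines "P \<equiv> ZA_poisson A star e" and "Q \<equiv> Pi_poisson A star e" and "Z \<equiv> ring_center A"
  shows
    "poisson_algebra R P \<and> commutative_poisson_algebra R Q \<and>
     (\<forall>p \<in> carrier P. \<forall>m \<in> carrier A.
        fst (p \<otimes>\<^bsub>P\<^esub> (\<zero>\<^bsub>A\<^esub>, m)) = \<zero>\<^bsub>A\<^esub> \<and> fst ((\<zero>\<^bsub>A\<^esub>, m) \<otimes>\<^bsub>P\<^esub> p) = \<zero>\<^bsub>A\<^esub> \<and>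
        fst (bracket P p (\<zero>\<^bsub>A\<^esub>, m)) = \<zero>\<^bsub>A\<^esub>) \<and>
     poisson_module R P A
       (\<lambda>p m. snd (p \<otimes>\<^bsub>P\<^esub> (\<zero>\<^bsub>A\<^esub>, m)))
       (\<lambda>m p. snd ((\<zero>\<^bsub>A\<^esub>, m) \<otimes>\<^bsub>P\<^esub> p))
       (\<lambda>p m. snd (bracket P p (\<zero>\<^bsub>A\<^esub>, m))) \<and>
     (\<exists>lact ract lie.
        poisson_module R Q A lact ract lie \<and>
        (\<forall>a \<in> Z. \<forall>a1 \<in> carrier A. \<forall>b \<in> carrier A.
           lact (a, Z +>\<^bsub>A\<^esub> a1) b = a \<otimes>\<^bsub>A\<^esub> b \<and>
           ract b (a, Z +>\<^bsub>A\<^esub> a1) = b \<otimes>\<^bsub>A\<^esub> a \<and> b \<otimes>\<^bsub>A\<^esub> a = a \<otimes>\<^bsub>A\<^esub> b \<and>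
           lie (a, Z +>\<^bsub>A\<^esub> a1) b = star_bracket A star 1 a b \<oplus>\<^bsub>A\<^esub> commutator A a1 b))"
proof -
  interpret D: formal_deformation R A star e by fact
  show ?thesis
    unfolding P_def Q_def Z_def
    using D.ZA_poisson_algebra D.Pi_commutative_poisson_algebra D.ZA_fst_zero D.ZA_poisson_module
      D.Pi_poisson_module
    by blast
qed

end
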